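(* Let $n\ge 2$ and let $\boldsymbol x=(x_1,\dots,x_n)$ be a random vector that is $L_p$-nested symmetric distributed with respect to some $L_p$-nested function $f:\mathbb R^n\to[0,\infty)$ and whose components $x_1,\dots,x_n$ are statistically independent. Then $\boldsymbol x$ is $L_p$-spherically symmetric distributed. In particular, $\boldsymbol x$ follows a $p$-generalized Normal distribution.
   Context: **$L_p$-nested functions.** An $L_p$-nested function $f:\mathbb R^n\to[0,\infty)$ is given by a finite rooted ordered tree whose $n$ leaves correspond to the coordinates $x_1,\dots,x_n$; every inner node $I$ has $\ell_I\ge 2$ children, denoted $(I,1),\dots,(I,\ell_I)$, and carries an exponent $p_I>0$. For a node $I$, $\boldsymbol x_I$ denotes the coordinates at leaves in the subtree under $I$. Put $f_I(\boldsymbol x_I)=|x_i|$ if $I$ is the leaf of $x_i$, and $f_I(\boldsymbol x_I)=\left(\sum_{k=1}^{\ell_I} f_{I,k}(\boldsymbol x_{I,k})^{p_I}\right)^{1/p_I}$ if $I$ is an inner node; $f=f_\emptyset$ is the function at the root $\emptyset$. **Distributions.** A random vector in $\mathbb R^n$ is $L_p$-nested symmetric with respect to $f$ if it has a Lebesgue density depending on $\boldsymbol x$ only through $f(\boldsymbol x)$. It is $L_p$-spherically symmetric if, for some $p>0$, it has a density depending on $\boldsymbol x$ only through $\|\boldsymbol x\|_p=(\sum_{i=1}^n|x_i|^p)^{1/p}$. A $p$-generalized Normal distribution is one with density proportional to $\exp(-\tau\|\boldsymbol x\|_p^p)$ for some $\tau>0$ and $p>0$. *)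

theory Defs
  imports "HOL-Probability.Probability"
begin

datatype 'n nested_tree = Leaf 'n | Node real "'n nested_tree list"

fun leaves :: "'n nested_tree \<Rightarrow> 'n list" where
  "leaves (Leaf i) = [i]"
| "leaves (Node p ts) = concat (map leaves ts)"

fun admissible :: "'n nested_tree \<Rightarrow> bool" where
  "admissible (Leaf i) \<longleftrightarrow> True"
| "admissible (Node p ts) \<longleftrightarrow> p > 0 \<and> length ts \<ge> 2 \<and> (\<forall>t\<in>set ts. admissible t)"

text \<open>The function of a subtree is applied to the whole vector, but it reads only the coordinates
  at the leaves of that subtree.\<close>

fun nested_eval :: "'n nested_tree \<Rightarrow> real ^ 'n \<Rightarrow> real" where
  "nested_eval (Leaf i) x = \<bar>x $ i\<bar>"
| "nested_eval (Node p ts) x = (\<Sum>t\<leftarrow>ts. nested_eval t x powr p) powr (1 / p)"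

definition Lp_nested_function :: "(real ^ 'n \<Rightarrow> real) \<Rightarrow> bool" where
  "Lp_nested_function f \<longleftrightarrow>
     (\<exists>T. admissible T \<and> distinct (leaves T) \<and> set (leaves T) = UNIV \<and> f = nested_eval T)"

text \<open>For \<open>p < 1\<close> this is only a quasi-norm.\<close>

definition Lp_norm :: "real \<Rightarrow> real ^ 'n \<Rightarrow> real" where
  "Lp_norm p x = (\<Sum>i\<in>UNIV. \<bar>x $ i\<bar> powr p) powr (1 / p)"

definition has_density_through ::
  "'a measure \<Rightarrow> ('a \<Rightarrow> real ^ 'n) \<Rightarrow> (real ^ 'n \<Rightarrow> real) \<Rightarrow> bool" where
  "has_density_through M X f \<longleftrightarrow> (\<exists>\<rho> :: real \<Rightarrow> ennreal. distributed M lborel X (\<lambda>x. \<rho> (f x)))"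

definition Lp_nested_symmetric ::
  "'a measure \<Rightarrow> ('a \<Rightarrow> real ^ 'n) \<Rightarrow> (real ^ 'n \<Rightarrow> real) \<Rightarrow> bool" where
  "Lp_nested_symmetric M X f \<longleftrightarrow> Lp_nested_function f \<and> has_density_through M X f"

definition Lp_spherically_symmetric :: "'a measure \<Rightarrow> ('a \<Rightarrow> real ^ 'n) \<Rightarrow> bool" where
  "Lp_spherically_symmetric M X \<longleftrightarrow> (\<exists>p>0. has_density_through M X (Lp_norm p))"

definition p_generalized_normal :: "'a measure \<Rightarrow> ('a \<Rightarrow> real ^ 'n) \<Rightarrow> bool" where
  "p_generalized_normal M X \<longleftrightarrow>
     (\<exists>p>0. \<exists>\<tau>>0. \<exists>c>0. distributed M lborel X (\<lambda>x. ennreal (c * exp (- \<tau> * Lp_norm p x powr p))))"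

end

(* Let g = rho o f be the density, so that g(x) = prod h_i(x_i) almost everywhere. Multiply the coordinate x_i
   by s^(1/p) and the leaves below the siblings of i by t^(1/p), where p is the exponent of the parent of i.
   By homogeneity f then depends on s and t only through s + r t, and since these diagonal maps preserve null
   sets, almost every x satisfies a Pexider equation H(s) K(t) = phi(s + r t) for almost all s, t > 0. Its
   locally integrable solutions are exponentials, hence h_i(y) = c_i exp(- tau_i |y|^p_i). Now
   E(x) = sum tau_i |x_i|^p_i is a function of f(x), and comparing the coordinate axes shows that all
   tau_i and all p_i agree. *)

theory Submission
  imports Defs
begin

text \<open>No regularity of the density is given, and its factorisation holds only almost
  everywhere, whereas a single \<open>x\<close> sees only its orbit under the two-parameter family
  of diagonal maps, in general a null set. So \<open>x\<close> has to be selected by a Fubini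
  argument. A generic orbit could still be useless: one of \<open>H\<close> and \<open>K\<close>
  might vanish almost everywhere, or \<open>K\<close> might fail to be locally integrable. Both are
  excluded at once by integrating the density over \<open>s\<close> and \<open>t\<close> against a
  weight that makes the total over \<open>x\<close> equal to 1: some orbit then carries a finite
  nonzero integral, and this integral factors.

  The siblings of \<open>i\<close> are scaled together because their joint contribution is then
  homogeneous whatever subtrees they are, and all ancestors see it only through its sum with the
  term of \<open>i\<close>. Each coordinate can thus be treated on its own, at the price of its own
  exponent. The axes, on which the exponents are finally compared, are null sets too; they are
  reached only because the exponent of the density and \<open>f\<close> are continuous.\<close>

section \<open>Diagonal maps, coordinates and null sets\<close>

definition diag_scale :: "('n \<Rightarrow> real) \<Rightarrow> real ^ 'n \<Rightarrow> real ^ 'n" where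
  "diag_scale d x = (\<chi> k. d k * x $ k)"

lemma diag_scale_nth [simp]: "diag_scale d x $ k = d k * x $ k"
  by (simp add: diag_scale_def)

lemma prod_Basis_vec:
  "(\<Prod>b\<in>(Basis :: (real ^ 'n) set). F b) = (\<Prod>k\<in>UNIV. F (axis k 1))"
proof -
  have B: "(Basis :: (real ^ 'n) set) = range (\<lambda>k. axis k 1)"
    by (auto simp: Basis_vec_def)
  have I: "inj (\<lambda>k :: 'n. axis k (1 :: real))"
    by (auto simp: inj_on_def axis_eq_axis)
  show ?thesis
    unfolding B by (simp only: prod.reindex[OF I] comp_def)
qed

lemma borel_measurable_vecI:
  fixes f :: "'a \<Rightarrow> real ^ 'n"
  assumes "\<And>k. (\<lambda>x. f x $ k) \<in> borel_measurable M"
  shows "f \<in> borel_measurable M"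
  unfolding borel_measurable_euclidean_space[of f]
  using assms by (auto simp: Basis_vec_def cart_eq_inner_axis)

lemma borel_measurable_vec_nth_compose [measurable (raw)]:
  fixes f :: "'a \<Rightarrow> real ^ 'n"
  assumes [measurable]: "f \<in> borel_measurable M"
  shows "(\<lambda>x. f x $ k) \<in> borel_measurable M"
  by (simp add: cart_eq_inner_axis)

lemma borel_measurable_diag_scale [measurable]: "diag_scale d \<in> borel_measurable borel"
  by (rule borel_measurable_vecI) simp

lemma nn_integral_diag_scale:
  fixes g :: "real ^ 'n \<Rightarrow> ennreal"
  assumes [measurable]: "g \<in> borel_measurable borel" and d: "\<And>k. d k \<noteq> 0"
  shows "ennreal (\<Prod>k\<in>UNIV. \<bar>d k\<bar>) * (\<integral>\<^sup>+x. g (diag_scale d x) \<partial>lborel) = (\<integral>\<^sup>+x. g x \<partial>lborel)"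
proof -
  \<comment> \<open>The affine change of variables takes its factors as a function on
    \<open>Basis\<close>; the inner product with the vector of all \<open>d k\<close> is such a
    function with value \<open>d k\<close> at \<open>axis k 1\<close>.\<close>
  define c :: "real ^ 'n \<Rightarrow> real" where "c b = (\<chi> k. d k) \<bullet> b" for b
  have c: "c (axis k 1) = d k" for k
    by (simp add: c_def inner_axis)
  have c0: "\<And>j. j \<in> Basis \<Longrightarrow> c j \<noteq> 0"
    using d c by (auto simp: Basis_vec_def)
  have T: "(0 + (\<Sum>j\<in>Basis. (c j * (x \<bullet> j)) *\<^sub>R j)) = diag_scale d x" for x
  proof (rule vec_eq_iff[THEN iffD2], rule allI)
    fix k
    have "(\<Sum>j\<in>Basis. (c j * (x \<bullet> j)) *\<^sub>R j) \<bullet> axis k 1 = c (axis k 1) * (x \<bullet> axis k 1)"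
      by (rule inner_sum_left_Basis) simp
    then show "(0 + (\<Sum>j\<in>Basis. (c j * (x \<bullet> j)) *\<^sub>R j)) $ k = diag_scale d x $ k"
      by (simp add: cart_eq_inner_axis[symmetric] c)
  qed
  have "(lborel :: (real ^ 'n) measure) = density (distr lborel borel (diag_scale d)) (\<lambda>_. \<Prod>k\<in>UNIV. \<bar>d k\<bar>)"
    using lborel_affine_euclidean[of c 0, OF c0] unfolding T by (simp add: prod_Basis_vec c)
  then have "(\<integral>\<^sup>+x. g x \<partial>lborel)
      = (\<integral>\<^sup>+x. g x \<partial>density (distr lborel borel (diag_scale d)) (\<lambda>_. \<Prod>k\<in>UNIV. \<bar>d k\<bar>))"
    by simp
  also have "\<dots> = ennreal (\<Prod>k\<in>UNIV. \<bar>d k\<bar>) * (\<integral>\<^sup>+x. g (diag_scale d x) \<partial>lborel)"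
    by (simp add: nn_integral_density nn_integral_distr nn_integral_cmult)
  finally show ?thesis ..
qed

text \<open>The Jacobian factor is nonzero, so the preimage of a Borel null set has measure
  zero.\<close>

lemma AE_diag_scale_fixed:
  fixes P :: "real ^ 'n \<Rightarrow> bool"
  assumes "AE x in lborel. P x" and d: "\<And>k. d k \<noteq> 0"
  shows "AE x in lborel. P (diag_scale d x)"
proof -
  obtain N where N: "{x \<in> space lborel. \<not> P x} \<subseteq> N" "emeasure lborel N = 0" "N \<in> sets lborel"
    using assms(1) by (rule AE_E)
  have [measurable]: "N \<in> sets borel"
    using N by simp
  have "ennreal (\<Prod>k\<in>UNIV. \<bar>d k\<bar>) * (\<integral>\<^sup>+x. indicator N (diag_scale d x) \<partial>lborel) = 0"
    using N by (subst nn_integral_diag_scale[OF _ d]) auto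
  then have "(\<integral>\<^sup>+x. indicator N (diag_scale d x) \<partial>lborel) = 0"
    using prod_pos[of UNIV "\<lambda>k. \<bar>d k\<bar>"] d by (auto simp: ennreal_eq_0_iff)
  then have "AE x in lborel. diag_scale d x \<notin> N"
    by (subst (asm) nn_integral_0_iff_AE) (auto simp: indicator_def split: if_splits)
  then show ?thesis
    by (rule eventually_mono) (use N in \<open>auto\<close>)
qed

text \<open>Fubini turns "for each parameter, almost every point" into "for almost every point,
  almost every parameter", which permits work along the orbit of one point. As \<open>P\<close> may
  be nonmeasurable, the exchange is made for a Borel null set that covers its exceptions.\<close>

lemma AE_diag_scale:
  fixes P :: "real ^ 'n \<Rightarrow> bool" and d :: "'b \<Rightarrow> 'n \<Rightarrow> real"
  assumes P: "AE x in lborel. P x" and "sigma_finite_measure N"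
    and [measurable]: "\<And>k. (\<lambda>\<theta>. d \<theta> k) \<in> borel_measurable N"
  shows "AE x in lborel. AE \<theta> in N. (\<forall>k. d \<theta> k \<noteq> 0) \<longrightarrow> P (diag_scale (d \<theta>) x)"
proof -
  interpret N: sigma_finite_measure N by fact
  interpret pair_sigma_finite N "lborel :: (real ^ 'n) measure" ..
  obtain B where B: "{x \<in> space lborel. \<not> P x} \<subseteq> B" "emeasure lborel B = 0" "B \<in> sets lborel"
    using P by (rule AE_E)
  have [measurable]: "B \<in> sets borel"
    using B by simp
  have [measurable]: "(\<lambda>z. diag_scale (d (fst z)) (snd z)) \<in> borel_measurable (N \<Otimes>\<^sub>M borel)"
    by (rule borel_measurable_vecI) simp
  have "AE x in lborel. x \<notin> B"
    using B by (intro AE_not_in) (auto simp: null_sets_def)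
  then have "AE x in lborel. (\<forall>k. d \<theta> k \<noteq> 0) \<longrightarrow> diag_scale (d \<theta>) x \<notin> B" for \<theta>
    using AE_diag_scale_fixed[of "\<lambda>x. x \<notin> B" "d \<theta>"] by (cases "\<forall>k. d \<theta> k \<noteq> 0") simp_all
  then have "AE \<theta> in N. AE x in lborel. (\<forall>k. d \<theta> k \<noteq> 0) \<longrightarrow> diag_scale (d \<theta>) x \<notin> B"
    by simp
  then have "AE x in lborel. AE \<theta> in N. (\<forall>k. d \<theta> k \<noteq> 0) \<longrightarrow> diag_scale (d \<theta>) x \<notin> B"
    by (subst (asm) AE_commute) measurable
  then show ?thesis
    using B by (elim eventually_mono) auto
qed

lemma nn_integral_prod_vec:
  fixes F :: "'n::finite \<Rightarrow> real \<Rightarrow> ennreal"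
  assumes [measurable]: "\<And>k. F k \<in> borel_measurable borel"
  shows "(\<integral>\<^sup>+x. (\<Prod>k\<in>UNIV. F k (x $ k)) \<partial>(lborel :: (real ^ 'n) measure))
    = (\<Prod>k\<in>UNIV. \<integral>\<^sup>+y. F k y \<partial>lborel)"
proof -
  define G :: "real ^ 'n \<Rightarrow> real \<Rightarrow> ennreal" where "G b = F (THE k. b = axis k 1)" for b
  have G: "G (axis k 1) = F k" for k
    by (simp add: G_def axis_eq_axis)
  have "(\<integral>\<^sup>+x. (\<Prod>b\<in>Basis. G b (x \<bullet> b)) \<partial>lborel) = (\<Prod>b\<in>Basis. \<integral>\<^sup>+y. G b y \<partial>lborel)"
    by (rule nn_integral_lborel_prod) (auto simp: G_def)
  then show ?thesis
    by (simp add: prod_Basis_vec G cart_eq_inner_axis[symmetric])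
qed

lemma null_sets_vec_nth:
  assumes "A \<in> null_sets lborel"
  shows "{x :: real ^ 'n. x $ i \<in> A} \<in> null_sets lborel"
proof -
  have [measurable]: "A \<in> sets borel"
    using assms by auto
  have [measurable]: "{x :: real ^ 'n. x $ i \<in> A} \<in> sets borel"
    by measurable
  have "emeasure lborel {x :: real ^ 'n. x $ i \<in> A}
      = (\<integral>\<^sup>+x. (\<Prod>k\<in>UNIV. (if k = i then indicator A else (\<lambda>_. 1)) (x $ k)) \<partial>(lborel :: (real ^ 'n) measure))"
  proof (subst nn_integral_indicator[symmetric], simp, rule nn_integral_cong)
    fix x :: "real ^ 'n"
    have "(\<Prod>k\<in>UNIV. (if k = i then indicator A else (\<lambda>_. 1)) (x $ k))
        = (\<Prod>k\<in>UNIV. if k = i then indicator A (x $ k) else (1 :: ennreal))"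
      by (rule prod.cong) auto
    then show "indicator {x. x $ i \<in> A} x
      = (\<Prod>k\<in>UNIV. (if k = i then indicator A else (\<lambda>_. 1)) (x $ k) :: ennreal)"
      by (simp add: indicator_def)
  qed
  also have "\<dots> = (\<Prod>k\<in>UNIV. \<integral>\<^sup>+y. (if k = i then indicator A else (\<lambda>_. 1)) y \<partial>lborel)"
    by (rule nn_integral_prod_vec) auto
  \<comment> \<open>The factor of coordinate \<open>i\<close> is 0. The other factors are infinite,
    but in \<open>ennreal\<close> the product is still 0.\<close>
  also have "\<dots> = 0"
    using assms by (auto simp: prod_zero_iff null_sets_def intro!: exI[of _ i])
  finally show ?thesis
    by (auto simp: null_sets_def)
qed

lemma AE_vec_nth:
  assumes "AE y in lborel. P y"
  shows "AE x in (lborel :: (real ^ 'n) measure). P (x $ i)"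
proof -
  obtain N where N: "{x \<in> space lborel. \<not> P x} \<subseteq> N" "emeasure lborel N = 0" "N \<in> sets lborel"
    using assms by (rule AE_E)
  then show ?thesis
    using null_sets_vec_nth[of N i] by (intro AE_I'[of "{x. x $ i \<in> N}"]) (auto simp: null_sets_def)
qed

lemma lborel_distr_uminus_vec: "distr lborel borel uminus = (lborel :: (real ^ 'n) measure)"
proof -
  have "(lborel :: (real ^ 'n) measure) = density (distr lborel borel uminus) (\<lambda>_. 1)"
    using lborel_affine[of "-1" "0 :: real ^ 'n"] by (simp add: uminus_add_conv_diff)
  then show ?thesis
    by (simp add: density_1)
qed

section \<open>Marginal densities and the product form\<close>

text \<open>Slabs over null sets are null, so the marginal is absolutely continuous and
  Radon-Nikodym supplies a density. Its symmetry comes from reflecting the whole vector, which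
  reflects every coordinate.\<close>

lemma (in prob_space) marginal_density:
  fixes X :: "'a \<Rightarrow> real ^ 'n"
  assumes D: "distributed M lborel X g" and even: "\<And>x. g (- x) = g x"
  obtains h :: "real \<Rightarrow> real" where "h \<in> borel_measurable borel" "\<And>y. 0 \<le> h y" "\<And>y. h (- y) = h y"
    "density lborel h = distr M borel (\<lambda>\<omega>. X \<omega> $ i)"
proof -
  have [measurable]: "X \<in> borel_measurable M" and g[measurable]: "g \<in> borel_measurable borel"
    and Dd: "distr M lborel X = density lborel g"
    using D by (auto simp: distributed_def)
  define \<mu> where "\<mu> = distr M borel (\<lambda>\<omega>. X \<omega> $ i)"
  have sets_\<mu>[measurable_cong]: "sets \<mu> = sets borel" and space_\<mu>: "space \<mu> = UNIV"
    by (simp_all add: \<mu>_def)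
  have \<mu>_eq: "\<mu> = distr (density lborel g) borel (\<lambda>x. x $ i)"
    unfolding Dd[symmetric] \<mu>_def by (subst distr_distr) (auto simp: comp_def)
  interpret \<mu>: prob_space \<mu>
    unfolding \<mu>_def by (rule prob_space_distr) simp
  have ac: "absolutely_continuous lborel \<mu>"
    unfolding absolutely_continuous_def
  proof
    fix A :: "real set" assume A: "A \<in> null_sets lborel"
    then have [measurable]: "A \<in> sets borel" by auto
    have "AE x in lborel. x $ i \<notin> A"
      using AE_not_in[OF null_sets_vec_nth[OF A, of i]] by simp
    then have "emeasure (density lborel g) {x. x $ i \<in> A} = 0"
      by (subst emeasure_density) (auto simp: nn_integral_0_iff_AE elim!: eventually_mono)
    then show "A \<in> null_sets \<mu>"
      unfolding \<mu>_eq by (auto simp: null_sets_def emeasure_distr vimage_def)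
  qed
  obtain h0 where h0[measurable]: "h0 \<in> borel_measurable lborel" and h0d: "density lborel h0 = \<mu>"
    using sigma_finite_measure.Radon_Nikodym[OF sigma_finite_lborel ac] sets_\<mu> by auto
  have int1: "(\<integral>\<^sup>+y. h0 y \<partial>lborel) = 1"
    using \<mu>.emeasure_space_1 unfolding h0d[symmetric] by (simp add: emeasure_density)
  have fin: "AE y in lborel. h0 y \<noteq> \<infinity>"
    using int1 by (intro nn_integral_noteq_infinite) auto
  have sym: "distr \<mu> borel uminus = \<mu>"
  proof -
    have "distr \<mu> borel uminus = distr (density lborel g) borel (\<lambda>x. - (x $ i))"
      unfolding \<mu>_eq by (subst distr_distr) (auto simp: comp_def)
    also have "\<dots> = distr (distr (density lborel (\<lambda>x. g (- x))) borel uminus) borel (\<lambda>x. x $ i)"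
      by (subst distr_distr) (auto simp: comp_def even)
    also have "distr (density lborel (\<lambda>x. g (- x))) borel uminus
        = density (distr lborel borel uminus) g"
      by (subst density_distr) auto
    also have "\<dots> = density lborel g"
      by (simp only: lborel_distr_uminus_vec)
    finally show ?thesis
      by (simp add: \<mu>_eq)
  qed
  have "density lborel (\<lambda>y. h0 (- y)) = density lborel h0"
  proof -
    have "density lborel h0 = distr (density lborel h0) borel uminus"
      using sym by (simp add: h0d)
    also have "\<dots> = distr (density (distr lborel borel uminus) h0) borel uminus"
      by (simp only: lborel_distr_uminus)
    also have "\<dots> = distr (distr (density lborel (\<lambda>y. h0 (- y))) borel uminus) borel uminus"
      by (subst density_distr) auto
    also have "\<dots> = distr (density lborel (\<lambda>y. h0 (- y))) borel (\<lambda>y. y)"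
      by (subst distr_distr) (auto simp: comp_def)
    also have "\<dots> = density lborel (\<lambda>y. h0 (- y))"
      by (intro measure_eqI) (auto simp: emeasure_distr)
    finally show ?thesis ..
  qed
  then have sym_AE: "AE y in lborel. h0 (- y) = h0 y"
    by (intro sigma_finite_measure.density_unique[OF sigma_finite_lborel]) auto
  \<comment> \<open>\<open>h0\<close> is finite and even only almost everywhere. Changing it on a
    null set yields a real function that is even at every point, so that it can later be evaluated
    at a given coordinate of unknown sign.\<close>
  define h where "h y = enn2real (h0 \<bar>y\<bar>)" for y
  have [measurable]: "h \<in> borel_measurable borel"
    unfolding h_def by measurable
  have "AE y in lborel. ennreal (h y) = h0 y"
    using fin sym_AE by eventually_elim (auto simp: h_def abs_if less_top)
  then have "density lborel h = \<mu>"
    unfolding h0d[symmetric] by (intro density_cong) (auto simp: h_def)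
  then show thesis
    by (intro that[of h]) (auto simp: h_def \<mu>_def)
qed

text \<open>Independence gives the product formula on open boxes. These are stable under
  intersection and generate the Borel sets, so the two measures coincide, and densities are unique
  up to null sets.\<close>

lemma (in prob_space) product_density:
  fixes X :: "'a \<Rightarrow> real ^ 'n"
  assumes D: "distributed M lborel X g" and even: "\<And>x. g (- x) = g x"
    and indep: "indep_vars (\<lambda>_. borel) (\<lambda>i \<omega>. X \<omega> $ i) UNIV"
  obtains h :: "'n \<Rightarrow> real \<Rightarrow> real" where "\<And>i. h i \<in> borel_measurable borel" "\<And>i y. 0 \<le> h i y"
    "\<And>i y. h i (- y) = h i y" "\<And>i. (\<integral>\<^sup>+y. h i y \<partial>lborel) = 1"
    "AE x in lborel. g x = ennreal (\<Prod>i\<in>UNIV. h i (x $ i))"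
proof -
  have [measurable]: "X \<in> borel_measurable M" and g[measurable]: "g \<in> borel_measurable borel"
    and Dd: "distr M lborel X = density lborel g"
    using D by (auto simp: distributed_def)
  define Q :: "'n \<Rightarrow> (real \<Rightarrow> real) \<Rightarrow> bool" where
    "Q i h \<longleftrightarrow> h \<in> borel_measurable borel \<and> (\<forall>y. 0 \<le> h y) \<and> (\<forall>y. h (- y) = h y) \<and>
      density lborel h = distr M borel (\<lambda>\<omega>. X \<omega> $ i)" for i h
  define h where "h i = (SOME h. Q i h)" for i
  have "\<exists>h. Q i h" for i
  proof -
    obtain k :: "real \<Rightarrow> real" where "k \<in> borel_measurable borel" "\<And>y. 0 \<le> k y"
      "\<And>y. k (- y) = k y" "density lborel k = distr M borel (\<lambda>\<omega>. X \<omega> $ i)"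
      using marginal_density[OF D even, where i = i] by blast
    then have "Q i k"
      by (simp add: Q_def)
    then show ?thesis by (rule exI[of _ k])
  qed
  then have Q: "Q i (h i)" for i
    unfolding h_def by (rule someI_ex)
  have h[measurable]: "h i \<in> borel_measurable borel" and h0: "0 \<le> h i y" and hs: "h i (- y) = h i y"
    and hd: "density lborel (h i) = distr M borel (\<lambda>\<omega>. X \<omega> $ i)" for i y
    using Q[of i] by (simp_all add: Q_def)
  have hp: "(\<integral>\<^sup>+y. ennreal (h i y) * indicator A y \<partial>lborel) = prob {\<omega> \<in> space M. X \<omega> $ i \<in> A}"
    if [measurable]: "A \<in> sets borel" for i A
  proof -
    have "emeasure (density lborel (h i)) A = emeasure M {\<omega> \<in> space M. X \<omega> $ i \<in> A}"
      unfolding hd by (simp add: emeasure_distr vimage_def Int_def conj_commute)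
    then show ?thesis
      by (simp add: emeasure_density emeasure_eq_measure)
  qed
  have h1: "(\<integral>\<^sup>+y. h i y \<partial>lborel) = 1" for i
    using hp[of UNIV i] by (simp add: prob_space)
  define G where "G x = ennreal (\<Prod>i\<in>UNIV. h i (x $ i))" for x :: "real ^ 'n"
  have [measurable]: "G \<in> borel_measurable borel"
    unfolding G_def by measurable
  have "density lborel g = density lborel G"
  proof (rule measure_eqI_generator_eq)
    let ?E = "range (\<lambda>(a, b). box a b :: (real ^ 'n) set)"
    show "Int_stable ?E"
      by (auto simp: Int_stable_def box_Int_box)
    show "?E \<subseteq> Pow UNIV" "sets (density lborel g) = sigma_sets UNIV ?E"
      "sets (density lborel G) = sigma_sets UNIV ?E"
      by (simp_all add: borel_eq_box)
    let ?A = "\<lambda>n::nat. box (- (real n *\<^sub>R One)) (real n *\<^sub>R One) :: (real ^ 'n) set"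
    show "range ?A \<subseteq> ?E" "(\<Union>i. ?A i) = UNIV"
      unfolding UN_box_eq_UNIV by auto
    show "emeasure (density lborel g) (?A i) \<noteq> \<infinity>" for i
      unfolding Dd[symmetric] by (simp add: emeasure_distr emeasure_eq_measure)
    fix B assume "B \<in> ?E"
    then obtain a b where B: "B = box a b"
      by auto
    define I where "I k = {a $ k <..< b $ k}" for k
    have I[measurable]: "I k \<in> sets borel" for k
      by (simp add: I_def)
    have BI: "x \<in> B \<longleftrightarrow> (\<forall>k. x $ k \<in> I k)" for x
      by (auto simp: B I_def mem_box_cart)
    have "emeasure (density lborel g) B = emeasure M {\<omega> \<in> space M. X \<omega> \<in> B}"
      unfolding Dd[symmetric] B by (simp add: emeasure_distr vimage_def Int_def conj_commute)
    also have "{\<omega> \<in> space M. X \<omega> \<in> B} = (\<Inter>k\<in>UNIV. (\<lambda>\<omega>. X \<omega> $ k) -` I k \<inter> space M)"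
      by (auto simp: BI)
    also have "emeasure M \<dots> = (\<Prod>k\<in>UNIV. ennreal (prob {\<omega> \<in> space M. X \<omega> $ k \<in> I k}))"
      using indep_varsD[OF indep, of UNIV I]
      by (simp add: emeasure_eq_measure prod_ennreal vimage_def Int_def conj_commute)
    also have "\<dots> = (\<Prod>k\<in>UNIV. \<integral>\<^sup>+y. ennreal (h k y) * indicator (I k) y \<partial>lborel)"
      by (simp add: hp)
    also have "\<dots> = (\<integral>\<^sup>+x. (\<Prod>k\<in>UNIV. ennreal (h k (x $ k)) * indicator (I k) (x $ k)) \<partial>lborel)"
      by (rule nn_integral_prod_vec[symmetric]) measurable
    also have "\<dots> = (\<integral>\<^sup>+x. G x * indicator B x \<partial>lborel)"
    proof (rule nn_integral_cong)
      fix x :: "real ^ 'n"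
      have "(\<Prod>k\<in>UNIV. indicator (I k) (x $ k)) = (indicator B x :: ennreal)"
        by (auto simp: indicator_def BI prod_zero_iff)
      then show "(\<Prod>k\<in>UNIV. ennreal (h k (x $ k)) * indicator (I k) (x $ k)) = G x * indicator B x"
        by (simp add: prod.distrib G_def prod_ennreal h0)
    qed
    also have "\<dots> = emeasure (density lborel G) B"
      by (simp add: emeasure_density B)
    finally show "emeasure (density lborel g) B = emeasure (density lborel G) B" .
  qed
  then have "AE x in lborel. g x = G x"
    by (intro sigma_finite_measure.density_unique[OF sigma_finite_lborel]) auto
  then show thesis
    by (intro that[of h]) (use h0 hs h1 in \<open>auto simp: G_def\<close>)
qed

section \<open>Nested functions under partial scaling\<close>

text \<open>The power \<open>1 / p\<close> makes the \<open>p\<close>-th powers of the scaled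
  entries linear in \<open>s\<close> and \<open>t\<close>. Since \<open>0 powr (1 / p) = 0\<close>,
  the choice \<open>t = 0\<close> switches off the coordinates in \<open>S\<close> and leaves a
  function of one variable.\<close>

definition two_scale :: "real \<Rightarrow> 'n \<Rightarrow> 'n set \<Rightarrow> real \<Rightarrow> real \<Rightarrow> 'n \<Rightarrow> real" where
  "two_scale p i S s t k = (if k = i then s powr (1 / p) else if k \<in> S then t powr (1 / p) else 1)"

lemma nested_eval_nonneg: "0 \<le> nested_eval T x"
  by (cases T) auto

lemma nested_eval_cong:
  "(\<And>k. k \<in> set (leaves T) \<Longrightarrow> x $ k = y $ k) \<Longrightarrow> nested_eval T x = nested_eval T y"
proof (induction T)
  case (Node p ts)
  have "nested_eval t x = nested_eval t y" if "t \<in> set ts" for t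
    using Node.IH[OF that] Node.prems that by auto
  then show ?case
    by (simp cong: map_cong)
qed simp

lemma nested_eval_uminus: "nested_eval T (- x) = nested_eval T x"
proof (induction T)
  case (Node p ts)
  then show ?case
    by (simp cong: map_cong)
qed simp

text \<open>Homogeneity is asked for only at the leaves of the subtree, so it applies to one branch
  of a vector of which other parts scale differently. The factor 0 is included: it yields the
  vanishing of branches without a nonzero leaf.\<close>

lemma nested_eval_scale:
  assumes "admissible T" "0 \<le> a" "\<And>k. k \<in> set (leaves T) \<Longrightarrow> y $ k = a * x $ k"
  shows "nested_eval T y = a * nested_eval T x"
  using assms
proof (induction T)
  case (Leaf i)
  then show ?case by (simp add: abs_mult)
next
  case (Node p ts)
  then have p: "p > 0"
    by simp
  have "nested_eval t y = a * nested_eval t x" if "t \<in> set ts" for t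
    using Node.IH[OF that] Node.prems that by auto
  then have "map (\<lambda>t. nested_eval t y powr p) ts = map (\<lambda>t. a powr p * nested_eval t x powr p) ts"
    using Node.prems(2) by (intro map_cong) (auto simp: powr_mult nested_eval_nonneg)
  then have "nested_eval (Node p ts) y = (a powr p * (\<Sum>t\<leftarrow>ts. nested_eval t x powr p)) powr (1 / p)"
    by (simp add: sum_list_const_mult cong: map_cong)
  also have "\<dots> = a * nested_eval (Node p ts) x"
    using p Node.prems by (simp add: powr_mult powr_powr sum_list_nonneg)
  finally show ?case .
qed

lemma nested_eval_pos:
  assumes "admissible T" "\<And>k. k \<in> set (leaves T) \<Longrightarrow> x $ k \<noteq> 0"
  shows "0 < nested_eval T x"
  using assms
proof (induction T)
  case (Node p ts)
  then obtain t us where ts: "ts = t # us"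
    by (cases ts) auto
  have "0 < nested_eval t x"
    using Node by (auto simp: ts)
  moreover have "0 \<le> (\<Sum>t\<leftarrow>us. nested_eval t x powr p)"
    by (rule sum_list_nonneg) auto
  ultimately have "0 < (\<Sum>t\<leftarrow>ts. nested_eval t x powr p)"
    by (simp add: ts add_pos_nonneg)
  then show ?case
    by simp
qed simp

lemma distinct_leaves_split:
  assumes "distinct (leaves (Node p ts))" "i \<in> set (leaves (Node p ts))"
  obtains as c bs where "ts = as @ c # bs" "i \<in> set (leaves c)" "distinct (leaves c)"
    "\<And>d. d \<in> set (as @ bs) \<Longrightarrow> set (leaves d) \<inter> set (leaves c) = {}"
proof -
  obtain c where "c \<in> set ts" and i: "i \<in> set (leaves c)"
    using assms(2) by auto
  then obtain as bs where ts: "ts = as @ c # bs"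
    by (auto simp: in_set_conv_decomp)
  show thesis
    by (rule that[OF ts i]) (use assms(1) in \<open>auto simp: ts\<close>)
qed

text \<open>Along an axis at most one branch at each node is nonzero, so the outer power
  \<open>1 / p\<close> undoes the inner power \<open>p\<close> at every level.\<close>

lemma nested_eval_axis:
  assumes "admissible T" "distinct (leaves T)"
  shows "nested_eval T (axis i r) = (if i \<in> set (leaves T) then \<bar>r\<bar> else 0)"
  using assms
proof (induction T)
  case (Leaf j)
  then show ?case by (simp add: axis_def)
next
  case (Node p ts)
  have p: "p > 0" using Node by simp
  have zero: "nested_eval d (axis i r) = 0" if "admissible d" "i \<notin> set (leaves d)" for d
  proof -
    have "nested_eval d (axis i r) = 0 * nested_eval d 0"
      using that by (intro nested_eval_scale) (auto simp: axis_def)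
    then show ?thesis by simp
  qed
  have sum0: "(\<Sum>d\<leftarrow>ds. nested_eval d (axis i r) powr p) = 0"
    if "\<And>d. d \<in> set ds \<Longrightarrow> admissible d \<and> i \<notin> set (leaves d)" for ds
    using that p by (induction ds) (auto simp: zero)
  show ?case
  proof (cases "i \<in> set (leaves (Node p ts))")
    case False
    then have "(\<Sum>d\<leftarrow>ts. nested_eval d (axis i r) powr p) = 0"
      using Node.prems by (intro sum0) auto
    then show ?thesis
      using False by simp
  next
    case True
    obtain as c bs where ts: "ts = as @ c # bs" and c: "i \<in> set (leaves c)" "distinct (leaves c)"
      and disj: "\<And>d. d \<in> set (as @ bs) \<Longrightarrow> set (leaves d) \<inter> set (leaves c) = {}"
      using distinct_leaves_split[OF Node.prems(2) True] by blast
    have "nested_eval c (axis i r) = \<bar>r\<bar>"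
      using Node.IH[of c] Node.prems(1) c by (simp add: ts)
    moreover have "(\<Sum>d\<leftarrow>as. nested_eval d (axis i r) powr p) = 0"
      "(\<Sum>d\<leftarrow>bs. nested_eval d (axis i r) powr p) = 0"
      using Node.prems(1) disj c by (auto simp: ts intro!: sum0)
    ultimately show ?thesis
      using True p by (simp add: ts powr_powr)
  qed
qed

lemma continuous_on_nested_eval:
  assumes "admissible T"
  shows "continuous_on UNIV (nested_eval T)"
  using assms
proof (induction T)
  case (Leaf i)
  then show ?case by (simp add: continuous_intros)
next
  case (Node p ts)
  then have p: "p > 0" and ts: "\<And>t. t \<in> set ts \<Longrightarrow> continuous_on UNIV (nested_eval t)"
    by auto
  have "continuous_on UNIV (\<lambda>x. \<Sum>t\<leftarrow>ts. nested_eval t x powr p)"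
    using ts
  proof (induction ts)
    case (Cons t us)
    then have "continuous_on UNIV (\<lambda>x. nested_eval t x powr p)"
      using p by (intro continuous_on_powr') (auto simp: nested_eval_nonneg)
    with Cons show ?case
      by (auto intro: continuous_intros)
  qed simp
  then show ?case
    using p by (auto intro!: continuous_on_powr' sum_list_nonneg)
qed

text \<open>As long as the coordinates outside \<open>insert i S\<close> are fixed, \<^term>\<open>nested_eval T x\<close> is a function of
  \<open>\<bar>x\<^sub>i\<bar>\<^sup>p + R\<close>, where \<open>p\<close> is the exponent of the parent of the leaf \<open>i\<close> and \<open>R\<close>, the contribution of the
  siblings of \<open>i\<close>, is homogeneous of degree \<open>p\<close> in the leaves \<open>S\<close> below them.\<close>

lemma nested_eval_two_scale:
  fixes T :: "'n::finite nested_tree"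
  assumes "admissible T" "distinct (leaves T)" "i \<in> set (leaves T)" "T \<noteq> Leaf i"
  shows "\<exists>p>0. \<exists>S. i \<notin> S \<and> S \<subseteq> set (leaves T) \<and> (\<forall>x. (\<forall>k. x $ k \<noteq> 0) \<longrightarrow>
    (\<exists>r>0. \<forall>s\<ge>0. \<forall>t\<ge>0. nested_eval T (diag_scale (two_scale p i S s t) x)
      = nested_eval T (diag_scale (two_scale p i S (s + r * t) 0) x)))"
  using assms
proof (induction T)
  case (Leaf j)
  then show ?case by simp
next
  case (Node q ts)
  obtain as c bs where ts: "ts = as @ c # bs" and c: "i \<in> set (leaves c)" "distinct (leaves c)"
    and disj: "\<And>d. d \<in> set (as @ bs) \<Longrightarrow> set (leaves d) \<inter> set (leaves c) = {}"
    using distinct_leaves_split[OF Node.prems(2,3)] by blast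
  have q: "q > 0" and adm: "\<And>d. d \<in> set ts \<Longrightarrow> admissible d" and ne: "as @ bs \<noteq> []"
    using Node.prems(1) by (auto simp: ts)
  show ?case
  proof (cases "c = Leaf i")
    case True
    define S where "S = (\<Union>d\<in>set (as @ bs). set (leaves d))"
    have S: "i \<notin> S" "S \<subseteq> set (leaves (Node q ts))"
      using disj c by (auto simp: S_def ts)
    have "\<exists>r>0. \<forall>s\<ge>0. \<forall>t\<ge>0. nested_eval (Node q ts) (diag_scale (two_scale q i S s t) x)
      = nested_eval (Node q ts) (diag_scale (two_scale q i S (s + r * t) 0) x)"
      if x: "\<forall>k. x $ k \<noteq> 0" for x
    proof -
      define R where "R = (\<Sum>d\<leftarrow>as @ bs. nested_eval d x powr q)"
      have "0 < nested_eval d x powr q" if "d \<in> set (as @ bs)" for d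
        using x that adm[of d] nested_eval_pos[of d x] by (auto simp: ts)
      \<comment> \<open>An inner node has at least two children, so the leaf \<open>i\<close> has a
        sibling and the sum is not empty.\<close>
      then have R: "R > 0"
        unfolding R_def using ne
        by (cases "as @ bs") (auto intro!: add_pos_nonneg sum_list_nonneg)
      have eval: "nested_eval (Node q ts) (diag_scale (two_scale q i S s t) x)
        = (s * \<bar>x $ i\<bar> powr q + t * R) powr (1 / q)" if "s \<ge> 0" "t \<ge> 0" for s t
      proof -
        let ?y = "diag_scale (two_scale q i S s t) x"
        have "nested_eval d ?y powr q = t * nested_eval d x powr q" if d: "d \<in> set (as @ bs)" for d
        proof -
          have "nested_eval d ?y = t powr (1 / q) * nested_eval d x"
          proof (rule nested_eval_scale)
            show "admissible d"
              using adm d by (auto simp: ts)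
            show "?y $ k = t powr (1 / q) * x $ k" if "k \<in> set (leaves d)" for k
              using S that d by (auto simp: S_def two_scale_def)
          qed simp
          then show ?thesis
            using q \<open>t \<ge> 0\<close> by (simp add: powr_mult powr_powr nested_eval_nonneg)
        qed
        then have "map (\<lambda>d. nested_eval d ?y powr q) as = map (\<lambda>d. t * nested_eval d x powr q) as"
          "map (\<lambda>d. nested_eval d ?y powr q) bs = map (\<lambda>d. t * nested_eval d x powr q) bs"
          by auto
        moreover have "nested_eval c ?y powr q = s * \<bar>x $ i\<bar> powr q"
          using q \<open>s \<ge> 0\<close> by (simp add: True two_scale_def abs_mult powr_mult powr_powr)
        ultimately show ?thesis
          by (simp add: ts R_def sum_list_const_mult algebra_simps cong: map_cong)
      qed
      \<comment> \<open>This makes \<open>s * \<bar>x $ i\<bar> powr q + t * R\<close> equal to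
        \<open>(s + r * t) * \<bar>x $ i\<bar> powr q\<close>, the value that belongs to the second
        scale 0.\<close>
      define r where "r = R / \<bar>x $ i\<bar> powr q"
      have "r > 0" "r * \<bar>x $ i\<bar> powr q = R"
        using R x by (simp_all add: r_def)
      then show ?thesis
        by (intro exI[of _ r]) (simp only: eval, simp add: eval algebra_simps del: nested_eval.simps)
    qed
    then show ?thesis
      using q S by (intro exI[of _ q] conjI exI[of _ S]) auto
  next
    case False
    \<comment> \<open>Above the parent of \<open>i\<close> the exponent and the set of the child
      through \<open>i\<close> are reused. The other children have disjoint leaves, so their terms
      stay constant.\<close>
    obtain p S where p: "p > 0" and S: "i \<notin> S" "S \<subseteq> set (leaves c)"
      and IH: "\<And>x. \<forall>k. x $ k \<noteq> 0 \<Longrightarrow> \<exists>r>0. \<forall>s\<ge>0. \<forall>t\<ge>0.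
        nested_eval c (diag_scale (two_scale p i S s t) x)
          = nested_eval c (diag_scale (two_scale p i S (s + r * t) 0) x)"
      using Node.IH[of c] adm[of c] c False by (auto simp: ts)
    have other: "nested_eval d (diag_scale (two_scale p i S s t) x) = nested_eval d x"
      if "d \<in> set (as @ bs)" for d s t x
      using disj[OF that] S c by (intro nested_eval_cong) (auto simp: two_scale_def)
    have eval: "nested_eval (Node q ts) (diag_scale (two_scale p i S s t) x)
        = ((\<Sum>d\<leftarrow>as. nested_eval d x powr q) + (nested_eval c (diag_scale (two_scale p i S s t) x) powr q
          + (\<Sum>d\<leftarrow>bs. nested_eval d x powr q))) powr (1 / q)" for s t x
      using other by (simp add: ts cong: map_cong)
    show ?thesis
    proof (rule exI[of _ p], rule conjI[OF p], rule exI[of _ S], intro conjI allI impI)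
      show "S \<subseteq> set (leaves (Node q ts))"
        using S by (auto simp: ts)
      fix x :: "real ^ 'n" assume "\<forall>k. x $ k \<noteq> 0"
      from IH[OF this] show "\<exists>r>0. \<forall>s\<ge>0. \<forall>t\<ge>0. nested_eval (Node q ts) (diag_scale (two_scale p i S s t) x)
        = nested_eval (Node q ts) (diag_scale (two_scale p i S (s + r * t) 0) x)"
        unfolding eval by metis
    qed (use p S in auto)
  qed
qed

section \<open>The Pexider equation almost everywhere\<close>

lemma AE_lborel_affine:
  fixes P :: "real \<Rightarrow> bool"
  assumes "AE x in lborel. P x" "c \<noteq> 0"
  shows "AE x in lborel. P (t + c * x)"
proof -
  obtain N where N: "{x \<in> space lborel. \<not> P x} \<subseteq> N" "emeasure lborel N = 0" "N \<in> sets lborel"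
    using assms(1) by (rule AE_E)
  then have [measurable]: "N \<in> sets borel"
    by simp
  have "AE x in lborel. x \<notin> N"
    using N by (intro AE_not_in) (auto simp: null_sets_def)
  then have "AE x in lborel. t + c * x \<notin> N"
    using assms(2) by (intro AE_borel_affine) auto
  then show ?thesis
    using N by (elim eventually_mono) auto
qed

text \<open>Integrating the equation over a window expresses \<open>m\<close> by differences of its
  own primitive. Continuity thus yields differentiability, and the equation becomes a linear
  differential equation.\<close>

lemma continuous_multiplicative_imp_exp:
  fixes m :: "real \<Rightarrow> real"
  assumes cont: "continuous_on {0..} m" and m0: "m 0 = 1"
    and mult: "\<And>x y. 0 \<le> x \<Longrightarrow> 0 \<le> y \<Longrightarrow> m (x + y) = m x * m y"
  obtains l where "\<And>x. 0 \<le> x \<Longrightarrow> m x = exp (l * x)"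
proof -
  have "\<exists>d>0. \<forall>x\<in>{0..}. dist x 0 < d \<longrightarrow> dist (m x) (m 0) < 1 / 2"
    using cont[unfolded continuous_on_iff, rule_format, of 0 "1 / 2"] by simp
  then obtain d where d: "d > 0" "\<And>x. 0 \<le> x \<Longrightarrow> x < d \<Longrightarrow> \<bar>m x - 1\<bar> < 1 / 2"
    by (auto simp: dist_real_def m0)
  \<comment> \<open>On \<open>{0..c}\<close> continuity at 0 keeps \<open>m\<close> above 1/2, so
    \<open>I\<close> is positive and can be divided by.\<close>
  define c where "c = d / 2"
  define I where "I = integral {0..c} m"
  have c: "c > 0"
    using d by (simp add: c_def)
  have contab: "continuous_on {a..b} m" if "0 \<le> a" for a b
    using cont by (rule continuous_on_subset) (use that in auto)
  have int: "m integrable_on {a..b}" if "0 \<le> a" for a b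
    using contab[OF that] by (rule integrable_continuous_real)
  have "integral {0..c} (\<lambda>_. 1 / 2) \<le> I"
    unfolding I_def
  proof (rule integral_le)
    fix x assume "x \<in> {0..c}"
    then show "1 / 2 \<le> m x"
      using d(2)[of x] c by (auto simp: c_def abs_if split: if_splits)
  qed (use int in auto)
  then have I: "I > 0"
    using c by (simp add: field_simps)
  define F where "F x = integral {0..x} m" for x
  have mI: "m x * I = F (x + c) - F x" if "0 \<le> x" for x
  proof -
    have "m x * I = integral {0..c} (\<lambda>y. m x * m y)"
      by (simp add: I_def)
    also have "\<dots> = integral {0..c} (\<lambda>y. m (x + y))"
      using that by (intro integral_cong) (auto simp: mult)
    also have "\<dots> = integral {x..x + c} m"
      using integral_shift_real_ivl[of x x "x + c" m] by (simp add: add.commute)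
    also have "\<dots> = F (x + c) - F x"
      using Henstock_Kurzweil_Integration.integral_combine[of 0 x "x + c" m] that c int[of 0 "x + c"]
      by (simp add: F_def)
    finally show ?thesis .
  qed
  \<comment> \<open>From \<open>m x * I = F (x + c) - F x\<close> the derivative of \<open>m\<close>
    is \<open>(m (x + c) - m x) / I\<close>, which is \<open>l * m x\<close> by
    multiplicativity.\<close>
  define l where "l = (m c - 1) / I"
  have m_deriv: "(m has_real_derivative l * m x) (at x within {0..B})" if x: "x \<in> {0..B}" for x B
  proof -
    have F: "(F has_real_derivative m y) (at y within {0..B + c})" if "y \<in> {0..B + c}" for y
      unfolding F_def using contab[of 0 "B + c"] that by (intro integral_has_real_derivative) auto
    have 1: "(F has_real_derivative m x) (at x within {0..B})"
      using x c by (intro DERIV_subset[OF F]) auto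
    have "((F \<circ> (\<lambda>x. x + c)) has_real_derivative m (x + c) * 1) (at x within {0..B})"
    proof (rule DERIV_image_chain)
      show "(F has_real_derivative m (x + c)) (at (x + c) within (\<lambda>x. x + c) ` {0..B})"
        using x c by (intro DERIV_subset[OF F]) auto
    qed (auto intro!: derivative_eq_intros)
    then have 2: "((\<lambda>x. F (x + c)) has_real_derivative m (x + c)) (at x within {0..B})"
      by (simp add: comp_def)
    have "((\<lambda>x. (F (x + c) - F x) / I) has_real_derivative (m (x + c) - m x) / I) (at x within {0..B})"
      by (rule DERIV_cdivide[OF DERIV_diff[OF 2 1]])
    moreover have "(m (x + c) - m x) / I = l * m x"
      using mult[of x c] x c by (simp add: l_def field_simps)
    ultimately have D: "((\<lambda>x. (F (x + c) - F x) / I) has_real_derivative l * m x) (at x within {0..B})"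
      by simp
    have eq: "(F (y + c) - F y) / I = m y" if "y \<in> {0..B}" for y
      using mI[of y] that I by (simp add: field_simps)
    show ?thesis
      by (rule has_field_derivative_transform_within[OF D zero_less_one x eq])
  qed
  have "m x = exp (l * x)" if "0 \<le> x" for x
  proof -
    have "((\<lambda>y. m y * exp (- l * y)) has_real_derivative 0) (at y within {0..x})" if "y \<in> {0..x}" for y
      using m_deriv[OF that] by (auto intro!: derivative_eq_intros)
    then have "\<exists>k. \<forall>y\<in>{0..x}. m y * exp (- l * y) = k"
      by (intro has_field_derivative_zero_constant) auto
    then obtain k where k: "\<And>y. y \<in> {0..x} \<Longrightarrow> m y * exp (- l * y) = k"
      by blast
    have "m x * exp (- l * x) = m 0 * exp (- l * 0)"
      using k[of x] k[of 0] that by simp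
    then show ?thesis
      by (simp add: m0 exp_minus field_simps)
  qed
  then show thesis
    by (rule that)
qed

text \<open>Fixing a window \<open>{a..b}\<close> and integrating the equation over \<open>t\<close> gives
  \<open>H (s + r x) = m x * H s\<close> for a continuous multiplicative \<open>m\<close>, which is an exponential.\<close>

lemma pexider_AE:
  fixes H K \<phi> :: "real \<Rightarrow> real"
  assumes [measurable]: "H \<in> borel_measurable borel" "K \<in> borel_measurable borel" "\<phi> \<in> borel_measurable borel"
    and r: "r > 0" and K0: "\<And>t. 0 \<le> K t"
    and eq: "AE s in lborel. AE t in lborel. 0 < s \<longrightarrow> 0 < t \<longrightarrow> H s * K t = \<phi> (s + r * t)"
    and Kint: "\<And>a b. 0 < a \<Longrightarrow> set_integrable lborel {a..b} K"
    and nzH: "\<not> (AE s in lborel. 0 < s \<longrightarrow> H s = 0)"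
    and nzK: "\<not> (AE t in lborel. 0 < t \<longrightarrow> K t = 0)"
  obtains c l where "AE s in lborel. 0 < s \<longrightarrow> H s = c * exp (l * s)"
proof -
  have nonneg: "0 \<le> (LINT t:{a..b}|lborel. K t)" for a b
    using K0 by (auto simp: set_lebesgue_integral_def intro!: integral_nonneg)
  \<comment> \<open>Otherwise \<open>K\<close> vanishes almost everywhere on each
    \<open>{1 / real (Suc n)..real (Suc n)}\<close>; these intervals exhaust the positive half-line,
    contrary to \<open>nzK\<close>.\<close>
  have "\<exists>a b. 0 < a \<and> 0 < (LINT t:{a..b}|lborel. K t)"
  proof (rule ccontr)
    assume neg: "\<not> ?thesis"
    have z: "(LINT t:{a..b}|lborel. K t) = 0" if "0 < a" for a b
    proof -
      have "\<not> 0 < (LINT t:{a..b}|lborel. K t)"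
        using neg that by blast
      with nonneg[of a b] show ?thesis
        by linarith
    qed
    have "AE t in lborel. t \<in> {1 / real (Suc n)..real (Suc n)} \<longrightarrow> K t = 0" for n
    proof -
      have "set_integrable lborel {1 / real (Suc n)..real (Suc n)} K"
        by (rule Kint) simp
      then have "integrable lborel (\<lambda>t. indicat_real {1 / real (Suc n)..real (Suc n)} t * K t)"
        by (simp add: set_integrable_def)
      moreover have "(LINT t|lborel. indicat_real {1 / real (Suc n)..real (Suc n)} t * K t) = 0"
        using z[of "1 / real (Suc n)" "real (Suc n)"] by (simp add: set_lebesgue_integral_def)
      moreover have "AE t in lborel. 0 \<le> indicat_real {1 / real (Suc n)..real (Suc n)} t * K t"
        using K0 by simp
      ultimately have "AE t in lborel. indicat_real {1 / real (Suc n)..real (Suc n)} t * K t = 0"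
        using integral_nonneg_eq_0_iff_AE by blast
      then show ?thesis
        by (rule eventually_mono) auto
    qed
    then have "AE t in lborel. \<forall>n. t \<in> {1 / real (Suc n)..real (Suc n)} \<longrightarrow> K t = 0"
      unfolding AE_all_countable by blast
    then have "AE t in lborel. 0 < t \<longrightarrow> K t = 0"
    proof (rule eventually_mono, intro impI)
      fix t :: real assume *: "\<forall>n. t \<in> {1 / real (Suc n)..real (Suc n)} \<longrightarrow> K t = 0" and "0 < t"
      obtain n where n: "max t (1 / t) \<le> real n"
        using real_arch_simple by blast
      then have "t \<in> {1 / real (Suc n)..real (Suc n)}"
        using \<open>0 < t\<close> by (auto simp: field_simps)
      then show "K t = 0"
        using * by blast
    qed
    then show False
      using nzK by blast
  qed
  then obtain a b where a: "0 < a" and ab: "0 < (LINT t:{a..b}|lborel. K t)"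
    by blast
  define \<kappa> where "\<kappa> x = (LINT t:{a + x..b + x}|lborel. K t)" for x
  have \<kappa>0: "\<kappa> 0 > 0"
    using ab by (simp add: \<kappa>_def)
  have "a \<le> b"
    using ab by (rule_tac ccontr) (simp add: set_lebesgue_integral_def)
  have \<kappa>_shift: "\<kappa> x = (LINT t:{a..b}|lborel. K (t + x))" for x
  proof -
    have "\<kappa> x = (LINT t|lborel. indicator {a + x..b + x} (x + 1 * t) *\<^sub>R K (x + 1 * t))"
      unfolding \<kappa>_def set_lebesgue_integral_def by (subst lborel_integral_real_affine[of 1 _ x]) auto
    also have "\<dots> = (LINT t:{a..b}|lborel. K (t + x))"
      unfolding set_lebesgue_integral_def
      by (intro Bochner_Integration.integral_cong) (auto simp: indicator_def add.commute)
    finally show ?thesis .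
  qed
  have \<kappa>_cont: "continuous_on {0..} \<kappa>"
  proof -
    define F where "F x = integral {a..x} K" for x
    have int: "K integrable_on {a..c}" for c
      using Kint[OF a] by (rule set_borel_integral_eq_integral)
    have F: "continuous_on {a..c} F" for c
      unfolding F_def using int by (rule indefinite_integral_continuous_1)
    have F': "continuous_on {a..} F"
    proof (rule continuous_on_eq_continuous_within[THEN iffD2], rule ballI)
      fix x assume "x \<in> {a..}"
      then have "continuous (at x within {a..x + 1}) F"
        using F[of "x + 1"] by (simp add: continuous_on_eq_continuous_within)
      moreover have "at x within {a..x + 1} = at x within {a..}"
        by (rule at_within_nhd[of x "{..<x + 1}"]) auto
      ultimately show "continuous (at x within {a..}) F"
        by simp
    qed
    have "\<kappa> x = F (b + x) - F (a + x)" if "0 \<le> x" for x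
    proof -
      have "\<kappa> x = integral {a + x..b + x} K"
        unfolding \<kappa>_def using that a by (intro set_borel_integral_eq_integral Kint) auto
      also have "\<dots> = F (b + x) - F (a + x)"
        using Henstock_Kurzweil_Integration.integral_combine[of a "a + x" "b + x" K] that \<open>a \<le> b\<close> int[of "b + x"]
        by (simp add: F_def)
      finally show ?thesis .
    qed
    moreover have "continuous_on {0..} (\<lambda>x. F (b + x) - F (a + x))"
      using \<open>a \<le> b\<close> by (intro continuous_intros continuous_on_compose2[OF F']) auto
    ultimately show ?thesis
      by (subst continuous_on_cong) auto
  qed
  define m where "m x = \<kappa> x / \<kappa> 0" for x
  \<comment> \<open>The equation at \<open>s\<close> and \<open>t + x\<close> and the one at
    \<open>s + r * x\<close> and \<open>t\<close> have the same right side. Equating the left sides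
    and integrating over the window removes \<open>t\<close> and leaves
    \<open>H s * \<kappa> x = H (s + r * x) * \<kappa> 0\<close>. The exceptional null set depends
    on \<open>x\<close>.\<close>
  have Hm: "AE s in lborel. 0 < s \<longrightarrow> H (s + r * x) = m x * H s" if x: "0 \<le> x" for x
    using eq AE_lborel_affine[OF eq one_neq_zero, of "r * x"]
  proof eventually_elim
    fix s
    assume 1: "AE t in lborel. 0 < s \<longrightarrow> 0 < t \<longrightarrow> H s * K t = \<phi> (s + r * t)"
      and 2: "AE t in lborel. 0 < r * x + 1 * s \<longrightarrow> 0 < t \<longrightarrow> H (r * x + 1 * s) * K t = \<phi> (r * x + 1 * s + r * t)"
    show "0 < s \<longrightarrow> H (s + r * x) = m x * H s"
    proof
      assume s: "0 < s"
      have "0 \<le> r * x"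
        using r x by simp
      have "AE t in lborel. 0 < x + 1 * t \<longrightarrow> H s * K (x + 1 * t) = \<phi> (s + r * (x + 1 * t))"
        using AE_lborel_affine[OF 1 one_neq_zero, of x] s by simp
      with 2 have "AE t in lborel. 0 < t \<longrightarrow> H s * K (t + x) = H (s + r * x) * K t"
        by eventually_elim (use s x \<open>0 \<le> r * x\<close> in \<open>auto simp: algebra_simps\<close>)
      then have "(LINT t:{a..b}|lborel. H s * K (t + x)) = (LINT t:{a..b}|lborel. H (s + r * x) * K t)"
        by (intro set_lebesgue_integral_cong_AE) (use a in \<open>auto elim!: eventually_mono\<close>)
      then have "H s * \<kappa> x = H (s + r * x) * \<kappa> 0"
        by (simp add: \<kappa>_shift)
      then show "H (s + r * x) = m x * H s"
        using \<kappa>0 by (simp add: m_def field_simps)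
    qed
  qed
  \<comment> \<open>The shift by \<open>x + y\<close> can be made at once or in two steps. If the
    resulting factors differed, \<open>H\<close> would vanish almost everywhere on the positive
    half-line.\<close>
  have "m (x + y) = m x * m y" if "0 \<le> x" "0 \<le> y" for x y
  proof (rule ccontr)
    assume ne: "m (x + y) \<noteq> m x * m y"
    have "AE s in lborel. 0 < r * x + 1 * s \<longrightarrow> H (r * x + 1 * s + r * y) = m y * H (r * x + 1 * s)"
      by (rule AE_lborel_affine[OF Hm]) (use that in auto)
    with Hm[OF add_nonneg_nonneg[OF that]] Hm[OF that(1)] have "AE s in lborel. 0 < s \<longrightarrow> H s = 0"
    proof eventually_elim
      case (elim s)
      show ?case
      proof
        assume s: "0 < s"
        have "0 \<le> r * x"
          using r that by simp
        then have "m (x + y) * H s = m x * m y * H s"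
          using elim s by (simp add: algebra_simps)
        then show "H s = 0"
          using ne by simp
      qed
    qed
    with nzH show False by simp
  qed
  moreover have "continuous_on {0..} m"
    unfolding m_def using \<kappa>_cont \<kappa>0 by (intro continuous_intros) auto
  moreover have "m 0 = 1"
    using \<kappa>0 by (simp add: m_def)
  ultimately obtain l where l: "\<And>x. 0 \<le> x \<Longrightarrow> m x = exp (l * x)"
    using continuous_multiplicative_imp_exp[of m] by blast
  \<comment> \<open>A step of \<open>r * x\<close> in the argument multiplies \<open>H\<close> by
    \<open>exp (l * x)\<close>, hence the rate \<open>l / r\<close>. What remains is invariant under
    every such step up to a null set, and has to be shown constant.\<close>
  define W where "W v = H v * exp (- (l / r) * v)" for v
  have [measurable]: "W \<in> borel_measurable borel"
    unfolding W_def by measurable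
  have "AE s in lborel. 0 < s \<longrightarrow> 0 \<le> x \<longrightarrow> W (s + r * x) = W s" for x
  proof (cases "0 \<le> x")
    case True
    show ?thesis
      using Hm[OF True]
    proof eventually_elim
      case (elim s)
      have "- (l / r) * (s + r * x) = - (l / r) * s - l * x"
        using r by (simp add: field_simps)
      then show ?case
        using elim True by (simp only: W_def) (simp add: l exp_diff)
    qed
  qed simp
  then have "AE x in lborel. AE s in lborel. 0 < s \<longrightarrow> 0 \<le> x \<longrightarrow> W (s + r * x) = W s"
    by simp
  then have "AE s in lborel. AE x in lborel. 0 < s \<longrightarrow> 0 \<le> x \<longrightarrow> W (s + r * x) = W s"
    by (subst lborel_pair.AE_commute) measurable
  \<comment> \<open>With \<open>v = s + r * x\<close> the value at \<open>s\<close> is compared with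
    almost every larger \<open>v\<close>; exchanging the variables once more covers almost every
    smaller one.\<close>
  then have up: "AE s in lborel. AE v in lborel. 0 < s \<longrightarrow> s < v \<longrightarrow> W v = W s"
  proof eventually_elim
    case (elim s)
    have "AE v in lborel. 0 < s \<longrightarrow> 0 \<le> - (s / r) + 1 / r * v \<longrightarrow> W (s + r * (- (s / r) + 1 / r * v)) = W s"
      by (rule AE_lborel_affine[OF elim]) (use r in auto)
    then show ?case
      by (rule eventually_mono) (use r in \<open>auto simp: field_simps\<close>)
  qed
  then have down: "AE v in lborel. AE s in lborel. 0 < s \<longrightarrow> s < v \<longrightarrow> W v = W s"
    by (subst lborel_pair.AE_commute) measurable
  have W: "AE s in lborel. AE v in lborel. 0 < s \<longrightarrow> 0 < v \<longrightarrow> W v = W s"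
    using up down
  proof eventually_elim
    case (elim s)
    from elim AE_lborel_singleton[of s] show ?case
      by eventually_elim (metis linorder_neqE_linordered_idom)
  qed
  \<comment> \<open>If there were no such \<open>s\<close>, then \<open>W\<close> would say that
    almost every \<open>s\<close> is nonpositive, which makes the negation of \<open>nzH\<close>
    hold trivially.\<close>
  have "\<exists>s. AE v in lborel. 0 < v \<longrightarrow> W v = W s"
  proof (rule ccontr)
    assume "\<not> ?thesis"
    with W have "AE s in lborel. 0 < s \<longrightarrow> H s = 0"
      by (elim eventually_mono) auto
    with nzH show False by simp
  qed
  then obtain s where "AE v in lborel. 0 < v \<longrightarrow> W v = W s" ..
  then have "AE v in lborel. 0 < v \<longrightarrow> H v = W s * exp ((l / r) * v)"
    by (rule eventually_mono) (auto simp: W_def exp_minus field_simps)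
  then show thesis
    by (rule that)
qed

section \<open>From a good orbit to the marginal densities\<close>

text \<open>The map from \<open>s\<close> to \<open>s powr (1 / p) * \<xi>\<close> is onto the
  positive half-line and differentiable there, so it carries null sets to null sets. The point 0,
  where differentiability may fail, is cut away.\<close>

lemma AE_powr_scale:
  fixes P :: "real \<Rightarrow> bool"
  assumes P: "AE s in lborel. 0 < s \<longrightarrow> P (s powr (1 / p) * \<xi>)" and p: "p > 0" and \<xi>: "\<xi> > 0"
  shows "AE y in lborel. 0 < y \<longrightarrow> P y"
proof -
  obtain N where N: "{s \<in> space lborel. \<not> (0 < s \<longrightarrow> P (s powr (1 / p) * \<xi>))} \<subseteq> N"
    "emeasure lborel N = 0" "N \<in> sets lborel"
    using P by (rule AE_E)
  have "N \<in> null_sets lebesgue"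
    using N by (intro null_sets_completionI) (auto simp: null_sets_def)
  then have "negligible (N \<inter> {0<..})"
    unfolding negligible_iff_null_sets[symmetric] by (rule negligible_subset) auto
  moreover have "(\<lambda>s. s powr (1 / p) * \<xi>) differentiable_on (N \<inter> {0<..})"
    unfolding differentiable_on_def
  proof
    fix s assume "s \<in> N \<inter> {0<..}"
    then have "((\<lambda>s. s powr (1 / p) * \<xi>) has_real_derivative (1 / p * s powr (1 / p - 1)) * \<xi>) (at s)"
      by (auto intro!: derivative_eq_intros)
    then show "(\<lambda>s. s powr (1 / p) * \<xi>) differentiable at s within N \<inter> {0<..}"
      using real_differentiable_def differentiable_at_withinI by blast
  qed
  ultimately have "negligible ((\<lambda>s. s powr (1 / p) * \<xi>) ` (N \<inter> {0<..}))"
    by (intro negligible_differentiable_image_negligible) auto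
  then have "AE y in lebesgue. y \<notin> (\<lambda>s. s powr (1 / p) * \<xi>) ` (N \<inter> {0<..})"
    unfolding negligible_iff_null_sets by (rule AE_not_in)
  then have "AE y in lborel. y \<notin> (\<lambda>s. s powr (1 / p) * \<xi>) ` (N \<inter> {0<..})"
    by (simp add: AE_completion_iff)
  then show ?thesis
  proof (rule eventually_mono)
    fix y assume y: "y \<notin> (\<lambda>s. s powr (1 / p) * \<xi>) ` (N \<inter> {0<..})"
    show "0 < y \<longrightarrow> P y"
    proof (intro impI, rule ccontr)
      assume y': "0 < y" "\<not> P y"
      define s where "s = (y / \<xi>) powr p"
      have s: "s powr (1 / p) * \<xi> = y" "0 < s"
        using y' p \<xi> by (simp_all add: s_def powr_powr)
      with y' have "s \<in> N"
        using N(1) by auto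
      with y s show False
        by (metis IntI greaterThan_iff imageI)
    qed
  qed
qed

lemma prod_insert_Compl:
  fixes F :: "'n::finite \<Rightarrow> 'b::comm_monoid_mult"
  assumes "i \<notin> S"
  shows "(\<Prod>k\<in>UNIV. F k) = F i * (\<Prod>k\<in>S. F k) * (\<Prod>k\<in>- insert i S. F k)"
proof -
  have "(\<Prod>k\<in>UNIV. F k) = (\<Prod>k\<in>insert i S. F k) * (\<Prod>k\<in>- insert i S. F k)"
    by (subst prod.union_disjoint[symmetric]) (auto simp: Compl_partition)
  then show ?thesis
    using assms by simp
qed

text \<open>The exponential density serves as a probability weight on the half-line that is bounded
  below on compact intervals.\<close>

lemma nn_integral_exponential_density:
  "(\<integral>\<^sup>+s. ennreal (exponential_density 1 s) \<partial>lborel) = 1"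
proof -
  interpret prob_space "density lborel (exponential_density 1)"
    by (rule prob_space_exponential_density) simp
  show ?thesis
    using emeasure_space_1 by (simp add: emeasure_density)
qed

text \<open>The power factors of \<open>ws\<close> and \<open>wt\<close> are the Jacobian of the diagonal map; with them the weighted
  integrals over \<open>s\<close> and \<open>t\<close> have total mass 1 in \<open>x\<close>, so that some \<open>x\<close> gives a finite nonzero one.\<close>

lemma density_two_scale_fibre:
  fixes g :: "real ^ 'n \<Rightarrow> ennreal" and p :: real
  assumes g[measurable]: "g \<in> borel_measurable borel" and g1: "(\<integral>\<^sup>+x. g x \<partial>lborel) = 1"
    and P: "AE x in lborel. g x = G x" and R: "AE x in lborel. R x"
    and iS: "i \<notin> S"
  defines "D \<equiv> \<lambda>s t. diag_scale (two_scale p i S s t)"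
  defines "ws \<equiv> \<lambda>s. s powr (1 / p) * exponential_density 1 s"
    and "wt \<equiv> \<lambda>t. (t powr (1 / p)) ^ card S * exponential_density 1 t"
  obtains x where "R x" "AE s in lborel. AE t in lborel. 0 < s \<longrightarrow> 0 < t \<longrightarrow> g (D s t x) = G (D s t x)"
    "(\<integral>\<^sup>+s. \<integral>\<^sup>+t. ennreal (ws s * wt t) * (indicator {0<..} s * indicator {0<..} t * g (D s t x)) \<partial>lborel \<partial>lborel) \<noteq> 0"
    "(\<integral>\<^sup>+s. \<integral>\<^sup>+t. ennreal (ws s * wt t) * (indicator {0<..} s * indicator {0<..} t * g (D s t x)) \<partial>lborel \<partial>lborel) \<noteq> \<infinity>"
proof -
  let ?N = "lborel \<Otimes>\<^sub>M lborel :: (real \<times> real) measure"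
  interpret X: pair_sigma_finite "lborel :: (real ^ 'n) measure" ?N ..
  define d where "d \<theta> = two_scale p i S (fst \<theta>) (snd \<theta>)" for \<theta>
  have d_meas[measurable]: "(\<lambda>\<theta>. d \<theta> k) \<in> borel_measurable ?N" for k
    unfolding d_def two_scale_def by measurable
  have [measurable]: "(\<lambda>z. diag_scale (d (snd z)) (fst z)) \<in> borel_measurable (borel \<Otimes>\<^sub>M ?N)"
    by (rule borel_measurable_vecI) simp
  have [measurable]: "ws \<in> borel_measurable borel" "wt \<in> borel_measurable borel"
    unfolding ws_def wt_def by measurable
  define q where "q x \<theta> = ennreal (ws (fst \<theta>) * wt (snd \<theta>)) *
    (indicator {0<..} (fst \<theta>) * indicator {0<..} (snd \<theta>) * g (diag_scale (d \<theta>) x))" for x \<theta>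
  have [measurable]: "(\<lambda>(x, \<theta>). q x \<theta>) \<in> borel_measurable (lborel \<Otimes>\<^sub>M ?N)"
    unfolding q_def by measurable
  \<comment> \<open>The coordinate axes of the parameter plane are excluded because the indicators
    vanish there while \<open>exponential_density 1 0\<close> is 1.\<close>
  have q_int: "(\<integral>\<^sup>+x. q x \<theta> \<partial>lborel) = ennreal (exponential_density 1 (fst \<theta>)) * ennreal (exponential_density 1 (snd \<theta>))"
    if "\<theta> \<notin> {0} \<times> UNIV \<union> UNIV \<times> {0}" for \<theta>
  proof (cases "0 < fst \<theta> \<and> 0 < snd \<theta>")
    case True
    define s t where "s = fst \<theta>" and "t = snd \<theta>"
    have st: "0 < s" "0 < t"
      using True by (auto simp: s_def t_def)
    have "(\<Prod>k\<in>UNIV. \<bar>d \<theta> k\<bar>) = s powr (1 / p) * (t powr (1 / p)) ^ card S"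
    proof -
      have "(\<Prod>k\<in>S. \<bar>d \<theta> k\<bar>) = (\<Prod>k\<in>S. t powr (1 / p))"
        using iS by (intro prod.cong) (auto simp: d_def two_scale_def t_def)
      moreover have "(\<Prod>k\<in>- insert i S. \<bar>d \<theta> k\<bar>) = 1"
        by (intro prod.neutral) (auto simp: d_def two_scale_def)
      ultimately show ?thesis
        by (simp add: prod_insert_Compl[OF iS]) (simp add: d_def two_scale_def s_def)
    qed
    then have w: "ws s * wt t = (exponential_density 1 s * exponential_density 1 t) * (\<Prod>k\<in>UNIV. \<bar>d \<theta> k\<bar>)"
      by (simp add: ws_def wt_def)
    have "(\<integral>\<^sup>+x. q x \<theta> \<partial>lborel) = (\<integral>\<^sup>+x. ennreal (exponential_density 1 s * exponential_density 1 t) *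
        (ennreal (\<Prod>k\<in>UNIV. \<bar>d \<theta> k\<bar>) * g (diag_scale (d \<theta>) x)) \<partial>lborel)"
      using st w exponential_density_nonneg[of 1]
      by (simp add: q_def s_def[symmetric] t_def[symmetric] ennreal_mult prod_nonneg mult.assoc)
    also have "\<dots> = ennreal (exponential_density 1 s * exponential_density 1 t) * (\<integral>\<^sup>+x. g x \<partial>lborel)"
    proof -
      have "d \<theta> k \<noteq> 0" for k
        using st by (simp add: d_def two_scale_def s_def t_def)
      then have "ennreal (\<Prod>k\<in>UNIV. \<bar>d \<theta> k\<bar>) * (\<integral>\<^sup>+x. g (diag_scale (d \<theta>) x) \<partial>lborel) = (\<integral>\<^sup>+x. g x \<partial>lborel)"
        by (intro nn_integral_diag_scale) simp_all
      then show ?thesis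
        by (simp add: nn_integral_cmult del: prod_ennreal)
    qed
    finally show ?thesis
      using exponential_density_nonneg[of 1] by (simp add: g1 s_def t_def ennreal_mult)
  next
    case False
    then have "fst \<theta> < 0 \<or> snd \<theta> < 0"
      using that by (cases \<theta>) auto
    then show ?thesis
      by (auto simp: q_def exponential_density_def)
  qed
  have null: "AE \<theta> in ?N. \<theta> \<notin> {0} \<times> UNIV \<union> UNIV \<times> {0}"
  proof -
    have "{0} \<times> UNIV \<union> UNIV \<times> {0 :: real} \<in> null_sets ?N"
      by (intro null_sets.Un) (auto simp: null_sets_def lborel.emeasure_pair_measure_Times)
    then show ?thesis
      by (rule AE_not_in)
  qed
  have "(\<integral>\<^sup>+x. \<integral>\<^sup>+\<theta>. q x \<theta> \<partial>?N \<partial>lborel) = (\<integral>\<^sup>+\<theta>. \<integral>\<^sup>+x. q x \<theta> \<partial>lborel \<partial>?N)"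
    by (rule X.Fubini'[symmetric]) measurable
  also have "\<dots> = (\<integral>\<^sup>+\<theta>. ennreal (exponential_density 1 (fst \<theta>)) * ennreal (exponential_density 1 (snd \<theta>)) \<partial>?N)"
    by (intro nn_integral_cong_AE eventually_mono[OF null] q_int)
  also have "\<dots> = 1"
    by (subst lborel.nn_integral_fst[symmetric])
       (auto simp: nn_integral_cmult nn_integral_exponential_density)
  finally have Q1: "(\<integral>\<^sup>+x. \<integral>\<^sup>+\<theta>. q x \<theta> \<partial>?N \<partial>lborel) = 1" .
  have Qfin: "AE x in lborel. (\<integral>\<^sup>+\<theta>. q x \<theta> \<partial>?N) \<noteq> \<infinity>"
    using Q1 by (intro nn_integral_noteq_infinite) auto
  have Q0: "\<not> (AE x in lborel. (\<integral>\<^sup>+\<theta>. q x \<theta> \<partial>?N) = 0)"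
    using Q1 by (subst nn_integral_0_iff_AE[symmetric]) auto
  have "AE x in lborel. AE \<theta> in ?N. (\<forall>k. d \<theta> k \<noteq> 0) \<longrightarrow>
      g (diag_scale (d \<theta>) x) = G (diag_scale (d \<theta>) x)"
    by (rule AE_diag_scale[OF P]) (auto intro: sigma_finite_pair_measure sigma_finite_lborel)
  then have G: "AE x in lborel. AE s in lborel. AE t in lborel. 0 < s \<longrightarrow> 0 < t \<longrightarrow> g (D s t x) = G (D s t x)"
  proof (rule eventually_mono)
    fix x
    assume "AE \<theta> in ?N. (\<forall>k. d \<theta> k \<noteq> 0) \<longrightarrow> g (diag_scale (d \<theta>) x) = G (diag_scale (d \<theta>) x)"
    then have "AE s in lborel. AE t in lborel. (\<forall>k. d (s, t) k \<noteq> 0) \<longrightarrow>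
        g (diag_scale (d (s, t)) x) = G (diag_scale (d (s, t)) x)"
      by (rule lborel_pair.AE_pair)
    then show "AE s in lborel. AE t in lborel. 0 < s \<longrightarrow> 0 < t \<longrightarrow> g (D s t x) = G (D s t x)"
      by (elim eventually_mono) (auto simp: d_def D_def two_scale_def elim!: eventually_mono)
  qed
  have q_iter: "(\<integral>\<^sup>+\<theta>. q x \<theta> \<partial>?N) = (\<integral>\<^sup>+s. \<integral>\<^sup>+t. ennreal (ws s * wt t) *
      (indicator {0<..} s * indicator {0<..} t * g (D s t x)) \<partial>lborel \<partial>lborel)" for x
    by (subst lborel.nn_integral_fst[symmetric]) (auto simp: q_def d_def D_def)
  \<comment> \<open>Total mass 1 makes the orbit integral finite almost everywhere but not zero
    almost everywhere. The other requirements hold almost everywhere, so if no \<open>x\<close> met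
    them all, the integral would vanish for almost every \<open>x\<close>.\<close>
  have "\<exists>x. R x \<and> (AE s in lborel. AE t in lborel. 0 < s \<longrightarrow> 0 < t \<longrightarrow> g (D s t x) = G (D s t x)) \<and>
    (\<integral>\<^sup>+\<theta>. q x \<theta> \<partial>?N) \<noteq> 0 \<and> (\<integral>\<^sup>+\<theta>. q x \<theta> \<partial>?N) \<noteq> \<infinity>"
  proof (rule ccontr)
    assume *: "\<not> ?thesis"
    have "AE x in lborel. (\<integral>\<^sup>+\<theta>. q x \<theta> \<partial>?N) = 0"
      using R G Qfin by eventually_elim (use * in blast)
    with Q0 show False by simp
  qed
  then show thesis
    unfolding q_iter using that by blast
qed

text \<open>The total mass 1 decides both signs: with \<open>c\<close> not positive the mass would
  be 0, and with \<open>l\<close> not negative the density would be at least \<open>c\<close> almost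
  everywhere and the mass infinite.\<close>

lemma even_density_exponential:
  fixes h :: "real \<Rightarrow> real"
  assumes [measurable]: "h \<in> borel_measurable borel" and nn: "\<And>y. 0 \<le> h y"
    and even: "\<And>y. h (- y) = h y" and int: "(\<integral>\<^sup>+y. h y \<partial>lborel) = 1"
    and eq: "AE y in lborel. 0 < y \<longrightarrow> h y = c * exp (l * y powr p)"
  shows "0 < c" "l < 0" "AE y in lborel. h y = c * exp (l * \<bar>y\<bar> powr p)"
proof -
  have "AE y in lborel. 0 < 0 + - 1 * y \<longrightarrow> h (0 + - 1 * y) = c * exp (l * (0 + - 1 * y) powr p)"
    by (rule AE_lborel_affine[OF eq]) simp
  with eq AE_lborel_singleton[of 0] show h: "AE y in lborel. h y = c * exp (l * \<bar>y\<bar> powr p)"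
  proof eventually_elim
    case (elim y)
    then show ?case
      by (cases "0 < y") (auto simp: even)
  qed
  show c: "0 < c"
  proof (rule ccontr)
    assume "\<not> 0 < c"
    then have "c * exp (l * \<bar>y\<bar> powr p) \<le> 0" for y
      by (intro mult_nonpos_nonneg) auto
    with h have "AE y in lborel. ennreal (h y) = 0"
      by (elim eventually_mono) (simp add: ennreal_eq_0_iff)
    then have "(\<integral>\<^sup>+y. h y \<partial>lborel) = 0"
      by (subst nn_integral_0_iff_AE) auto
    with int show False by simp
  qed
  show "l < 0"
  proof (rule ccontr)
    assume "\<not> l < 0"
    then have "c \<le> c * exp (l * \<bar>y\<bar> powr p)" for y
      using c by simp
    with h have "AE y in lborel. ennreal c \<le> ennreal (h y)"
      by (elim eventually_mono) (simp add: ennreal_leI)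
    then have "(\<integral>\<^sup>+y. ennreal c \<partial>(lborel :: real measure)) \<le> (\<integral>\<^sup>+y. h y \<partial>(lborel :: real measure))"
      by (rule nn_integral_mono_AE)
    with int c show False
      by (simp add: ennreal_mult_top top_unique)
  qed
qed

lemma nested_marginal_exponential:
  fixes T :: "'n::finite nested_tree" and \<rho> :: "real \<Rightarrow> ennreal"
  assumes T: "admissible T" "distinct (leaves T)" "i \<in> set (leaves T)" "T \<noteq> Leaf i"
    and g[measurable]: "(\<lambda>x. \<rho> (nested_eval T x)) \<in> borel_measurable borel"
    and g1: "(\<integral>\<^sup>+x. \<rho> (nested_eval T x) \<partial>lborel) = 1"
    and h[measurable]: "\<And>k. h k \<in> borel_measurable borel" and h0: "\<And>k y. 0 \<le> h k y"
    and hs: "\<And>k y. h k (- y) = h k y" and h1: "\<And>k. (\<integral>\<^sup>+y. h k y \<partial>lborel) = 1"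
    and prod: "AE x in lborel. \<rho> (nested_eval T x) = ennreal (\<Prod>k\<in>UNIV. h k (x $ k))"
  shows "\<exists>p>0. \<exists>c>0. \<exists>\<tau>>0. AE y in lborel. h i y = c * exp (- \<tau> * \<bar>y\<bar> powr p)"
proof -
  obtain p S where p: "0 < p" and iS: "i \<notin> S"
    and shift: "\<And>x. \<forall>k. x $ k \<noteq> 0 \<Longrightarrow> \<exists>r>0. \<forall>s\<ge>0. \<forall>t\<ge>0.
      nested_eval T (diag_scale (two_scale p i S s t) x)
        = nested_eval T (diag_scale (two_scale p i S (s + r * t) 0) x)"
    using nested_eval_two_scale[OF T] by blast
  define D where "D s t = diag_scale (two_scale p i S s t)" for s t
  define ws where "ws s = s powr (1 / p) * exponential_density 1 s" for s
  define wt where "wt t = (t powr (1 / p)) ^ card S * exponential_density 1 t" for t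
  have "AE x in (lborel :: (real ^ 'n) measure). x $ k \<noteq> 0" for k
    by (rule AE_vec_nth[OF AE_lborel_singleton])
  then have ne0: "AE x in (lborel :: (real ^ 'n) measure). \<forall>k. x $ k \<noteq> 0"
    by (rule eventually_all_finite)
  obtain x where x: "\<forall>k. x $ k \<noteq> 0"
    and eq: "AE s in lborel. AE t in lborel. 0 < s \<longrightarrow> 0 < t \<longrightarrow>
      \<rho> (nested_eval T (D s t x)) = ennreal (\<Prod>k\<in>UNIV. h k (D s t x $ k))"
    and Q0: "(\<integral>\<^sup>+s. \<integral>\<^sup>+t. ennreal (ws s * wt t) *
      (indicator {0<..} s * indicator {0<..} t * \<rho> (nested_eval T (D s t x))) \<partial>lborel \<partial>lborel) \<noteq> 0"
    and Qfin: "(\<integral>\<^sup>+s. \<integral>\<^sup>+t. ennreal (ws s * wt t) *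
      (indicator {0<..} s * indicator {0<..} t * \<rho> (nested_eval T (D s t x))) \<partial>lborel \<partial>lborel) \<noteq> \<infinity>"
    using density_two_scale_fibre[OF g g1 prod ne0 iS, of p]
    unfolding D_def[symmetric] ws_def[symmetric] wt_def[symmetric] by blast
  obtain r where r: "0 < r" and rD: "\<And>s t. 0 \<le> s \<Longrightarrow> 0 \<le> t \<Longrightarrow>
      nested_eval T (D s t x) = nested_eval T (D (s + r * t) 0 x)"
    using shift[OF x] unfolding D_def by blast
  \<comment> \<open>The coordinates that do not move along the orbit contribute a constant, which is
    absorbed into \<open>H\<close>.\<close>
  define B where "B = (\<Prod>k\<in>- insert i S. h k (x $ k))"
  define H where "H s = h i (s powr (1 / p) * x $ i) * B" for s
  define K where "K t = (\<Prod>k\<in>S. h k (t powr (1 / p) * x $ k))" for t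
  define \<phi> where "\<phi> v = enn2real (\<rho> (nested_eval T (D v 0 x)))" for v
  have [measurable]: "H \<in> borel_measurable borel" "K \<in> borel_measurable borel"
    unfolding H_def K_def by measurable
  have [measurable]: "(\<lambda>v. D v 0 x) \<in> borel_measurable borel"
    unfolding D_def by (rule borel_measurable_vecI) (simp add: two_scale_def)
  have [measurable]: "\<phi> \<in> borel_measurable borel"
    unfolding \<phi>_def by (intro measurable_compose[OF _ measurable_compose[OF g borel_measurable_enn2real]]) measurable
  have [measurable]: "ws \<in> borel_measurable borel" "wt \<in> borel_measurable borel"
    unfolding ws_def wt_def by measurable
  have ws0: "0 \<le> ws s" and wt0: "0 \<le> wt s" for s
    using exponential_density_nonneg[of 1] by (auto simp: ws_def wt_def)
  have B0: "0 \<le> B"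
    unfolding B_def by (intro prod_nonneg) (auto simp: h0)
  have H0: "0 \<le> H s" and K0: "0 \<le> K s" for s
    using B0 by (auto simp: H_def K_def h0 intro!: prod_nonneg)
  have HK: "(\<Prod>k\<in>UNIV. h k (D s t x $ k)) = H s * K t" for s t
  proof -
    have "(\<Prod>k\<in>S. h k (D s t x $ k)) = K t"
      unfolding K_def using iS by (intro prod.cong) (auto simp: D_def two_scale_def)
    moreover have "(\<Prod>k\<in>- insert i S. h k (D s t x $ k)) = B"
      unfolding B_def by (intro prod.cong) (auto simp: D_def two_scale_def)
    ultimately show ?thesis
      by (simp add: prod_insert_Compl[OF iS] H_def) (simp add: D_def two_scale_def)
  qed
  define HI where "HI = (\<integral>\<^sup>+s. ennreal (ws s * H s) * indicator {0<..} s \<partial>lborel)"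
  define KI where "KI = (\<integral>\<^sup>+t. ennreal (wt t * K t) * indicator {0<..} t \<partial>lborel)"
  \<comment> \<open>Along the orbit the integral splits into \<open>HI * KI\<close>. Being nonzero,
    it shows that neither \<open>H\<close> nor \<open>K\<close> is degenerate; being finite with
    \<open>HI\<close> nonzero, it bounds \<open>KI\<close> and so gives local integrability of
    \<open>K\<close>.\<close>
  have "(\<integral>\<^sup>+s. \<integral>\<^sup>+t. ennreal (ws s * wt t) *
      (indicator {0<..} s * indicator {0<..} t * \<rho> (nested_eval T (D s t x))) \<partial>lborel \<partial>lborel)
    = (\<integral>\<^sup>+s. \<integral>\<^sup>+t. (ennreal (ws s * H s) * indicator {0<..} s) * (ennreal (wt t * K t) * indicator {0<..} t) \<partial>lborel \<partial>lborel)"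
    using eq
  proof (intro nn_integral_cong_AE, eventually_elim)
    case (elim s)
    then show ?case
    proof (intro nn_integral_cong_AE, eventually_elim)
      case (elim t)
      then show ?case
        by (auto simp: HK indicator_def ennreal_mult[symmetric] ws0 wt0 H0 K0 mult_ac)
    qed
  qed
  also have "\<dots> = HI * KI"
    by (simp add: HI_def KI_def nn_integral_cmult nn_integral_multc)
  finally have "HI * KI \<noteq> 0" "HI * KI \<noteq> \<infinity>"
    using Q0 Qfin by auto
  then have HI: "HI \<noteq> 0" and KI: "KI \<noteq> 0" "KI \<noteq> \<infinity>"
    by (auto simp: ennreal_mult_eq_top_iff)
  have nzH: "\<not> (AE s in lborel. 0 < s \<longrightarrow> H s = 0)"
  proof
    assume "AE s in lborel. 0 < s \<longrightarrow> H s = 0"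
    then have "HI = 0"
      unfolding HI_def by (subst nn_integral_0_iff_AE) (auto simp: indicator_def elim!: eventually_mono)
    with HI show False by simp
  qed
  have nzK: "\<not> (AE t in lborel. 0 < t \<longrightarrow> K t = 0)"
  proof
    assume "AE t in lborel. 0 < t \<longrightarrow> K t = 0"
    then have "KI = 0"
      unfolding KI_def by (subst nn_integral_0_iff_AE) (auto simp: indicator_def elim!: eventually_mono)
    with KI show False by simp
  qed
  have Kint: "set_integrable lborel {a..b} K" if a: "0 < a" for a b
  proof -
    \<comment> \<open>A lower bound for the weight \<open>wt\<close> on \<open>{a..b}\<close>: the
      increasing power factor is taken at \<open>a\<close>, the decreasing exponential at
      \<open>b\<close>.\<close>
    define C where "C = (a powr (1 / p)) ^ card S * exp (- b)"
    have C: "0 < C"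
      using a by (simp add: C_def)
    have CK: "ennreal C * ennreal (indicator {a..b} t * K t) \<le> ennreal (wt t * K t) * indicator {0<..} t" for t
    proof (cases "t \<in> {a..b}")
      case True
      then have "C \<le> wt t"
        using a p unfolding C_def wt_def
        by (intro mult_mono power_mono powr_mono2) (auto simp: exponential_density_def)
      then show ?thesis
        using True a C K0[of t] by (simp add: ennreal_mult[symmetric] mult_right_mono)
    qed simp
    have "ennreal C * (\<integral>\<^sup>+t. ennreal (indicator {a..b} t * K t) \<partial>lborel) \<le> KI"
      unfolding KI_def by (subst nn_integral_cmult[symmetric]) (auto intro!: nn_integral_mono CK)
    then have "(\<integral>\<^sup>+t. ennreal (indicator {a..b} t * K t) \<partial>lborel) < \<infinity>"
    proof -
      assume le: "ennreal C * (\<integral>\<^sup>+t. ennreal (indicator {a..b} t * K t) \<partial>lborel) \<le> KI"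
      show ?thesis
      proof (rule ccontr)
        assume "\<not> ?thesis"
        then have "(\<integral>\<^sup>+t. ennreal (indicator {a..b} t * K t) \<partial>lborel) = \<infinity>"
          by (simp add: less_top[symmetric])
        with le C KI show False
          by (simp add: ennreal_mult_top top_unique)
      qed
    qed
    then show ?thesis
      unfolding set_integrable_def using K0
      by (intro integrableI_nonneg) auto
  qed
  have pex: "AE s in lborel. AE t in lborel. 0 < s \<longrightarrow> 0 < t \<longrightarrow> H s * K t = \<phi> (s + r * t)"
    using eq
  proof eventually_elim
    case (elim s)
    then show ?case
    proof eventually_elim
      case (elim t)
      show ?case
      proof (intro impI)
        assume st: "0 < s" "0 < t"
        then have "\<rho> (nested_eval T (D (s + r * t) 0 x)) = ennreal (H s * K t)"
          using elim rD[of s t] by (simp add: HK)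
        then show "H s * K t = \<phi> (s + r * t)"
          by (simp add: \<phi>_def H0 K0)
      qed
    qed
  qed
  obtain c l where Hcl: "AE s in lborel. 0 < s \<longrightarrow> H s = c * exp (l * s)"
    using pexider_AE[OF _ _ _ r K0 pex Kint nzH nzK] by auto
  have "B \<noteq> 0"
    using nzH by (auto simp: H_def)
  define \<xi> where "\<xi> = \<bar>x $ i\<bar>"
  have \<xi>: "0 < \<xi>"
    using x by (simp add: \<xi>_def)
  have even: "h i (a * x $ i) = h i (a * \<xi>)" for a
    using hs[of i "a * x $ i"] by (simp add: \<xi>_def abs_if)
  \<comment> \<open>The new variable \<open>y = s powr (1 / p) * \<xi>\<close> satisfies
    \<open>y powr p = s * \<xi> powr p\<close>, so the rate \<open>l\<close> in \<open>s\<close>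
    becomes \<open>l / \<xi> powr p\<close>. Evenness allows \<open>\<xi>\<close> in place of the
    coordinate itself.\<close>
  have "AE s in lborel. 0 < s \<longrightarrow> h i (s powr (1 / p) * \<xi>)
      = c / B * exp (l / \<xi> powr p * (s powr (1 / p) * \<xi>) powr p)"
    using Hcl
  proof eventually_elim
    case (elim s)
    show ?case
    proof
      assume s: "0 < s"
      then have "(s powr (1 / p) * \<xi>) powr p = s * \<xi> powr p"
        using p \<xi> by (simp add: powr_mult powr_powr)
      moreover have "H s = h i (s powr (1 / p) * \<xi>) * B"
        by (simp only: H_def even)
      ultimately show "h i (s powr (1 / p) * \<xi>) = c / B * exp (l / \<xi> powr p * (s powr (1 / p) * \<xi>) powr p)"
        using elim s \<open>B \<noteq> 0\<close> \<xi> by (simp add: field_simps)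
    qed
  qed
  then have "AE y in lborel. 0 < y \<longrightarrow> h i y = c / B * exp (l / \<xi> powr p * y powr p)"
    by (rule AE_powr_scale[OF _ p \<xi>])
  note even_density_exponential[OF h h0 hs h1 this]
  then show ?thesis
    using p by (intro exI[of _ p] conjI exI[of _ "c / B"] exI[of _ "- (l / \<xi> powr p)"]) auto
qed

section \<open>Equality of the exponents and rates\<close>

text \<open>The set where the two functions differ is open, and a nonempty open set is never
  null.\<close>

lemma continuous_on_AE_eq:
  fixes u v :: "'a::euclidean_space \<Rightarrow> real"
  assumes "open S" "continuous_on S u" "continuous_on S v"
    and AE: "AE x in lborel. x \<in> S \<longrightarrow> u x = v x" and "x \<in> S"
  shows "u x = v x"
proof (rule ccontr)
  assume "u x \<noteq> v x"
  define A where "A = S \<inter> (\<lambda>x. u x - v x) -` (- {0})"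
  have "open A"
    unfolding A_def using assms by (intro continuous_open_preimage continuous_intros) auto
  moreover have "x \<in> A"
    using \<open>u x \<noteq> v x\<close> \<open>x \<in> S\<close> by (simp add: A_def)
  ultimately have "\<not> negligible A"
    using open_not_negligible by blast
  moreover have "AE x in lborel. x \<notin> A"
    using AE by (rule eventually_mono) (auto simp: A_def)
  then have "A \<in> null_sets lborel"
    using \<open>open A\<close> by (subst (asm) AE_iff_null_sets[symmetric]) auto
  then have "negligible A"
    by (simp add: negligible_iff_null_sets null_sets_completionI)
  ultimately show False
    by simp
qed

text \<open>By homogeneity of \<open>f\<close> the exponent \<open>E\<close> is a continuous function \<open>F\<close> of \<open>f\<close>. On each coordinate axis
  \<open>f\<close> is the absolute value, so \<open>F r = \<tau>\<^sub>i r\<^sup>p\<^sup>i\<close> for every \<open>i\<close>.\<close>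

lemma nested_exponential_parameters_eq:
  fixes T :: "'n::finite nested_tree" and p \<tau> :: "'n \<Rightarrow> real"
  assumes T: "admissible T" "distinct (leaves T)" "set (leaves T) = UNIV"
    and p: "\<And>k. 0 < p k" and \<tau>: "\<And>k. 0 < \<tau> k" and C: "0 < C"
    and eq: "AE x in lborel. \<rho> (nested_eval T x) = ennreal (C * exp (- (\<Sum>k\<in>UNIV. \<tau> k * \<bar>x $ k\<bar> powr p k)))"
  shows "\<tau> i = \<tau> j" "p i = p j"
proof -
  define E where "E x = (\<Sum>k\<in>UNIV. \<tau> k * \<bar>x $ k\<bar> powr p k)" for x :: "real ^ 'n"
  define f where "f = nested_eval T"
  have E_cont: "continuous_on UNIV E"
    unfolding E_def using p by (intro continuous_intros continuous_on_powr') (auto intro!: continuous_intros)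
  have f_cont: "continuous_on UNIV f"
    unfolding f_def using T(1) by (rule continuous_on_nested_eval)
  have "AE x in lborel. AE r in lborel. (\<forall>k::'n. r \<noteq> 0) \<longrightarrow>
      \<rho> (f (diag_scale (\<lambda>_. r) x)) = ennreal (C * exp (- E (diag_scale (\<lambda>_. r) x)))"
    using eq unfolding f_def E_def by (rule AE_diag_scale) (simp_all add: sigma_finite_lborel)
  moreover have "AE x in (lborel :: (real ^ 'n) measure). x $ k \<noteq> 0" for k
    by (rule AE_vec_nth[OF AE_lborel_singleton])
  then have "AE x in (lborel :: (real ^ 'n) measure). \<forall>k. x $ k \<noteq> 0"
    by (rule eventually_all_finite)
  \<comment> \<open>By homogeneity the point \<open>(r / f x) *\<^sub>R x\<close> has
    \<open>f\<close>-value \<open>r\<close>, so almost every single ray already determines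
    \<open>\<rho>\<close> at almost every positive \<open>r\<close>.\<close>
  ultimately have ray: "AE x in lborel. 0 < f x \<and>
      (AE r in lborel. 0 < r \<longrightarrow> \<rho> r = ennreal (C * exp (- E ((r / f x) *\<^sub>R x))))"
  proof eventually_elim
    case (elim x)
    have fx: "0 < f x"
      unfolding f_def using T(1) elim(2) by (intro nested_eval_pos) auto
    have "AE r in lborel. (\<forall>k::'n. 0 + 1 / f x * r \<noteq> 0) \<longrightarrow>
        \<rho> (f (diag_scale (\<lambda>_. 0 + 1 / f x * r) x)) = ennreal (C * exp (- E (diag_scale (\<lambda>_. 0 + 1 / f x * r) x)))"
      by (rule AE_lborel_affine[OF elim(1)]) (use fx in auto)
    then have "AE r in lborel. 0 < r \<longrightarrow> \<rho> r = ennreal (C * exp (- E ((r / f x) *\<^sub>R x)))"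
    proof eventually_elim
      case (elim r)
      have D: "diag_scale (\<lambda>_. 0 + 1 / f x * r) x = (r / f x) *\<^sub>R x"
        by (simp add: vec_eq_iff)
      show ?case
      proof
        assume r: "0 < r"
        have "f ((r / f x) *\<^sub>R x) = r / f x * f x"
          unfolding f_def using T(1) r fx by (intro nested_eval_scale) (auto simp: f_def)
        then show "\<rho> r = ennreal (C * exp (- E ((r / f x) *\<^sub>R x)))"
          using elim r fx by (simp only: D) simp
      qed
    qed
    with fx show ?case
      by simp
  qed
  \<comment> \<open>One typical ray is fixed as a reference; the exponent along it becomes
    \<open>F\<close>.\<close>
  then obtain y where fy: "0 < f y"
    and y: "AE r in lborel. 0 < r \<longrightarrow> \<rho> r = ennreal (C * exp (- E ((r / f y) *\<^sub>R y)))"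
    using eventually_happens'[OF _ ray] by (auto simp: trivial_limit_def[symmetric] ae_filter_eq_bot_iff)
  define F where "F r = E ((r / f y) *\<^sub>R y)" for r
  have F_cont: "continuous_on UNIV F"
    unfolding F_def using fy by (intro continuous_on_compose2[OF E_cont] continuous_intros) auto
  \<comment> \<open>Two typical rays give the same \<open>\<rho> r\<close>, hence the same exponent
    for almost every \<open>r\<close>, and by continuity for every positive \<open>r\<close>. The
    choice \<open>r = f x\<close> returns to \<open>x\<close> itself.\<close>
  have "AE x in lborel. x \<in> UNIV \<longrightarrow> E x = F (f x)"
    using ray
  proof eventually_elim
    case (elim x)
    have "AE r in lborel. r \<in> {0<..} \<longrightarrow> E ((r / f x) *\<^sub>R x) = F r"
      using elim[THEN conjunct2] y
    proof eventually_elim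
      case (elim r)
      then show ?case
        using C by (auto simp: F_def)
    qed
    then have "E ((f x / f x) *\<^sub>R x) = F (f x)"
      using elim
      by (intro continuous_on_AE_eq[of "{0<..}" "\<lambda>r. E ((r / f x) *\<^sub>R x)" F])
         (auto intro!: continuous_on_compose2[OF E_cont] continuous_intros continuous_on_subset[OF F_cont])
    then show ?case
      using elim by simp
  qed
  \<comment> \<open>The identity must hold at every point, since the axes on which it is used next
    may form a null set.\<close>
  then have EF: "E x = F (f x)" for x
    by (rule continuous_on_AE_eq[OF open_UNIV E_cont, rotated])
       (auto intro!: continuous_on_compose2[OF F_cont f_cont])
  have F: "F r = \<tau> k * r powr p k" if "0 < r" for r k
  proof -
    have "E (axis k r) = (\<Sum>l\<in>UNIV. if l = k then \<tau> k * r powr p k else 0)"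
      unfolding E_def using that by (intro sum.cong) (auto simp: axis_def)
    then show ?thesis
      using that T EF[of "axis k r"] by (simp add: f_def nested_eval_axis)
  qed
  \<comment> \<open>At \<open>r = 1\<close> the powers disappear and the coefficients can be
    compared; \<open>r = 2\<close> then separates the exponents.\<close>
  show \<tau>_eq: "\<tau> i = \<tau> j"
    using F[of 1 i] F[of 1 j] by simp
  have "2 powr p i = 2 powr p j"
    using F[of 2 i] F[of 2 j] \<tau>[of j] by (simp add: \<tau>_eq)
  then show "p i = p j"
    by (simp add: powr_inj)
qed

section \<open>Assembling the joint density\<close>

lemma Lp_norm_powr:
  assumes "p > 0"
  shows "Lp_norm p x powr p = (\<Sum>k\<in>UNIV. \<bar>x $ k\<bar> powr p)"
  using assms by (simp add: Lp_norm_def powr_powr sum_nonneg)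

theorem proposition5:
  fixes M :: "'a measure" and X :: "'a \<Rightarrow> real ^ 'n" and f :: "real ^ 'n \<Rightarrow> real"
  assumes "prob_space M"
    and "CARD('n) \<ge> 2"
    and "Lp_nested_symmetric M X f"
    and "prob_space.indep_vars M (\<lambda>_. borel) (\<lambda>i \<omega>. X \<omega> $ i) UNIV"
  shows "Lp_spherically_symmetric M X \<and> p_generalized_normal M X"
proof -
  interpret prob_space M by fact
  obtain T \<rho> where T: "admissible T" "distinct (leaves T)" "set (leaves T) = UNIV" "f = nested_eval T"
    and D: "distributed M lborel X (\<lambda>x. \<rho> (nested_eval T x))"
    using assms(3) by (auto simp: Lp_nested_symmetric_def Lp_nested_function_def has_density_through_def)
  have [measurable]: "X \<in> borel_measurable M" and g: "(\<lambda>x. \<rho> (nested_eval T x)) \<in> borel_measurable borel"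
    and Dd: "distr M lborel X = density lborel (\<lambda>x. \<rho> (nested_eval T x))"
    using D by (auto simp: distributed_def)
  have g1: "(\<integral>\<^sup>+x. \<rho> (nested_eval T x) \<partial>lborel) = 1"
  proof -
    have "emeasure (density lborel (\<lambda>x. \<rho> (nested_eval T x))) UNIV = 1"
      unfolding Dd[symmetric] by (simp add: emeasure_distr emeasure_space_1)
    then show ?thesis
      using g by (simp add: emeasure_density)
  qed
  obtain h where h: "\<And>i. h i \<in> borel_measurable borel" "\<And>i y. 0 \<le> h i y"
    "\<And>i y. h i (- y) = h i y" "\<And>i. (\<integral>\<^sup>+y. h i y \<partial>lborel) = 1"
    and prod: "AE x in lborel. \<rho> (nested_eval T x) = ennreal (\<Prod>i\<in>UNIV. h i (x $ i))"
    by (rule product_density[OF D _ assms(4)]) (auto simp: nested_eval_uminus)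
  have "T \<noteq> Leaf i" for i
  proof
    assume "T = Leaf i"
    then have "CARD('n) = card {i}"
      using T(3) by simp
    then show False
      using assms(2) by simp
  qed
  then have "\<exists>p>0. \<exists>c>0. \<exists>\<tau>>0. AE y in lborel. h i y = c * exp (- \<tau> * \<bar>y\<bar> powr p)" for i
    using T by (intro nested_marginal_exponential[OF _ _ _ _ g g1 h prod]) auto
  then obtain p c \<tau> where p: "\<And>i. 0 < p i" and c: "\<And>i. 0 < c i" and \<tau>: "\<And>i. 0 < \<tau> i"
    and hi: "\<And>i. AE y in lborel. h i y = c i * exp (- \<tau> i * \<bar>y\<bar> powr p i)"
    by metis
  define C where "C = (\<Prod>i\<in>UNIV. c i)"
  have C: "0 < C"
    unfolding C_def using c by (intro prod_pos) auto
  have "AE x in (lborel :: (real ^ 'n) measure). h i (x $ i) = c i * exp (- \<tau> i * \<bar>x $ i\<bar> powr p i)" for i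
    by (rule AE_vec_nth[OF hi])
  then have "AE x in (lborel :: (real ^ 'n) measure). \<forall>i. h i (x $ i) = c i * exp (- \<tau> i * \<bar>x $ i\<bar> powr p i)"
    by (rule eventually_all_finite)
  with prod have g_eq: "AE x in lborel. \<rho> (nested_eval T x)
      = ennreal (C * exp (- (\<Sum>k\<in>UNIV. \<tau> k * \<bar>x $ k\<bar> powr p k)))"
  proof eventually_elim
    case (elim x)
    then show ?case
      by (simp add: C_def prod.distrib exp_sum[symmetric] sum_negf)
  qed
  \<comment> \<open>All coordinates share their parameters, so any index can represent them;
    \<open>undefined\<close> is just some element of the index type.\<close>
  define q t where "q = p undefined" and "t = \<tau> undefined"
  have "\<tau> k = t" "p k = q" for k
    unfolding t_def q_def by (rule nested_exponential_parameters_eq[OF T(1-3) p \<tau> C g_eq])+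
  then have q: "0 < q" and t: "0 < t"
    and g_q: "AE x in lborel. \<rho> (nested_eval T x) = ennreal (C * exp (- t * Lp_norm q x powr q))"
    using p[of undefined] \<tau>[of undefined] g_eq by (simp_all add: Lp_norm_powr sum_distrib_left sum_negf)
  have meas: "(\<lambda>x :: real ^ 'n. ennreal (C * exp (- t * Lp_norm q x powr q))) \<in> borel_measurable borel"
    unfolding Lp_norm_def by measurable
  have "density lborel (\<lambda>x. \<rho> (nested_eval T x)) = density lborel (\<lambda>x. ennreal (C * exp (- t * Lp_norm q x powr q)))"
    using g meas g_q by (intro density_cong) auto
  then have dist: "distributed M lborel X (\<lambda>x. ennreal (C * exp (- t * Lp_norm q x powr q)))"
    using Dd meas by (simp add: distributed_def)
  then have "has_density_through M X (Lp_norm q)"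
    unfolding has_density_through_def
    by (intro exI[of _ "\<lambda>u. ennreal (C * exp (- t * u powr q))"])
  with dist q t C show ?thesis
    unfolding Lp_spherically_symmetric_def p_generalized_normal_def by blast
qed

end
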